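(* Let $p(y_1,y_2|x_1,x_2)$ be a discrete memoryless interference channel, let $U_1\sim p(u_1)$ and $U_2\sim p(u_2)$ be independent sources on finite alphabets, and let $V_1=h_1(U_1)$, $V_2=h_2(U_2)$ for deterministic functions $h_1,h_2$. Sources $U_1$ and $U_2$ can be transmitted reliably to their respective receivers over the channel with side information $V_1=h_1(U_1)$ at Receiver 2 and side information $V_2=h_2(U_2)$ at Receiver 1 if $$(H(V_1),\,H(U_1|V_1),\,H(V_2),\,H(U_2|V_2))\in\mathrm{int}(\mathcal{C}_I),$$ where $\mathrm{int}(\cdot)$ denotes the interior and $\mathcal{C}_I$ denotes the capacity region (set of rate quadruplets $(R_{1s},R_{1p},R_{2s},R_{2p})$) of the interference channel with message side information at the receivers. Conversely, if $(H(V_1),H(U_1|V_1),H(V_2),H(U_2|V_2))\notin\mathcal{C}_I$, then sources $U_1$ and $U_2$ cannot be transmitted reliably.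
   Context: Channel: a discrete memoryless interference channel has finite input alphabets $\mathcal{X}_1,\mathcal{X}_2$, finite output alphabets $\mathcal{Y}_1,\mathcal{Y}_2$, and transition probability $p(y_1,y_2|x_1,x_2)$; $n$ uses of the channel are governed by the product law $\prod_{i=1}^n p(y_{1,i},y_{2,i}|x_{1,i},x_{2,i})$. Logarithms are base 2. Notation: $A^n=(A_1,\dots,A_n)$. Sources: $(U_{1,i},U_{2,i})_{i\ge1}$ are i.i.d. with law $p(u_1)p(u_2)$ on the finite alphabet $\mathcal{U}_1\times\mathcal{U}_2$, and $V_{k,i}=h_k(U_{k,i})\in\mathcal{V}_k$ for $k=1,2$ and all $i$. Source-channel code: Transmitter $k$ sends $X_k^n=f_k^n(U_k^n)$, where $f_k^n:\mathcal{U}_k^n\to\mathcal{X}_k^n$. Receiver 1 outputs $\hat U_1^n=g_1^n(Y_1^n,V_2^n)$ with $g_1^n:\mathcal{Y}_1^n\times\mathcal{V}_2^n\to\mathcal{U}_1^n$, and Receiver 2 outputs $\hat U_2^n=g_2^n(Y_2^n,V_1^n)$ with $g_2^n:\mathcal{Y}_2^n\times\mathcal{V}_1^n\to\mathcal{U}_2^n$. The error probability is $P_e^n=\Pr\{(U_1^n,U_2^n)\ne(\hat U_1^n,\hat U_2^n)\}$. The sources can be transmitted reliably if there is a sequence $(f_1^n,f_2^n,g_1^n,g_2^n)$ with $P_e^n\to0$ as $n\to\infty$. Interference channel with message side information: Transmitter $k$ has messages $W_{ks}\in\{1,\dots,2^{nR_{ks}}\}$ and $W_{kp}\in\{1,\dots,2^{nR_{kp}}\}$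 for Receiver $k$; all four messages are independent and uniform. Receiver 2 is given $W_{1s}$ and Receiver 1 is given $W_{2s}$. A $(2^{nR_{1s}},2^{nR_{1p}},2^{nR_{2s}},2^{nR_{2p}},n)$ code consists of encoders mapping $(W_{ks},W_{kp})$ to $X_k^n\in\mathcal{X}_k^n$, $k=1,2$, a decoder mapping $(Y_1^n,W_{2s})$ to an estimate of $(W_{1s},W_{1p})$, and a decoder mapping $(Y_2^n,W_{1s})$ to an estimate of $(W_{2s},W_{2p})$. Its average error probability is the probability (averaged over uniform messages) that at least one of the two estimates is wrong. A nonnegative rate quadruplet $(R_{1s},R_{1p},R_{2s},R_{2p})$ is achievable if there is a sequence of such codes with average error probability tending to $0$ as $n\to\infty$; $\mathcal{C}_I$ is the closure of the set of achievable quadruplets. *)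

theory Defs
  imports "HOL-Probability.Probability"
begin

text \<open>
  A sequence \<open>a\<^sup>n = (a\<^sub>1, \<dots>, a\<^sub>n)\<close> is an extensional function on the index set \<open>{..<n}\<close>, so that
  equality of two sequences is equality at the \<open>n\<close> indices only. The default value
  \<^const>\<open>undefined\<close> of \<^const>\<open>Pi_pmf\<close> below is the one \<^const>\<open>PiE\<close> uses outside the index set.
\<close>

definition words :: "nat \<Rightarrow> (nat \<Rightarrow> 'a) set" where
  "words n = {..<n} \<rightarrow>\<^sub>E UNIV"

definition map_word :: "nat \<Rightarrow> ('a \<Rightarrow> 'b) \<Rightarrow> (nat \<Rightarrow> 'a) \<Rightarrow> (nat \<Rightarrow> 'b)" where
  "map_word n h a = (\<lambda>i\<in>{..<n}. h (a i))"

definition iid_pmf :: "nat \<Rightarrow> 'a pmf \<Rightarrow> (nat \<Rightarrow> 'a) pmf" where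
  "iid_pmf n p = Pi_pmf {..<n} undefined (\<lambda>_. p)"

text \<open>A discrete memoryless interference channel: \<open>W x\<^sub>1 x\<^sub>2\<close> is the law of \<open>(Y\<^sub>1, Y\<^sub>2)\<close>.\<close>

type_synonym ('x1, 'x2, 'y1, 'y2) ichannel = "'x1 \<Rightarrow> 'x2 \<Rightarrow> ('y1 \<times> 'y2) pmf"

definition channel_pmf ::
  "('x1, 'x2, 'y1, 'y2) ichannel \<Rightarrow> nat \<Rightarrow> (nat \<Rightarrow> 'x1) \<Rightarrow> (nat \<Rightarrow> 'x2) \<Rightarrow> (nat \<Rightarrow> 'y1 \<times> 'y2) pmf" where
  "channel_pmf W n x1 x2 = Pi_pmf {..<n} undefined (\<lambda>i. W (x1 i) (x2 i))"


section \<open>Source-channel codes\<close>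

definition source_code ::
  "nat \<Rightarrow> ((nat \<Rightarrow> 'u1) \<Rightarrow> (nat \<Rightarrow> 'x1)) \<Rightarrow> ((nat \<Rightarrow> 'u2) \<Rightarrow> (nat \<Rightarrow> 'x2))
   \<Rightarrow> ((nat \<Rightarrow> 'y1) \<times> (nat \<Rightarrow> 'v2) \<Rightarrow> (nat \<Rightarrow> 'u1)) \<Rightarrow> ((nat \<Rightarrow> 'y2) \<times> (nat \<Rightarrow> 'v1) \<Rightarrow> (nat \<Rightarrow> 'u2)) \<Rightarrow> bool" where
  "source_code n f1 f2 g1 g2 \<longleftrightarrow>
     f1 \<in> words n \<rightarrow> words n \<and> f2 \<in> words n \<rightarrow> words n \<and>
     g1 \<in> words n \<times> words n \<rightarrow> words n \<and> g2 \<in> words n \<times> words n \<rightarrow> words n"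

definition source_error ::
  "('x1, 'x2, 'y1, 'y2) ichannel \<Rightarrow> 'u1 pmf \<Rightarrow> 'u2 pmf \<Rightarrow> ('u1 \<Rightarrow> 'v1) \<Rightarrow> ('u2 \<Rightarrow> 'v2) \<Rightarrow> nat
   \<Rightarrow> ((nat \<Rightarrow> 'u1) \<Rightarrow> (nat \<Rightarrow> 'x1)) \<Rightarrow> ((nat \<Rightarrow> 'u2) \<Rightarrow> (nat \<Rightarrow> 'x2))
   \<Rightarrow> ((nat \<Rightarrow> 'y1) \<times> (nat \<Rightarrow> 'v2) \<Rightarrow> (nat \<Rightarrow> 'u1)) \<Rightarrow> ((nat \<Rightarrow> 'y2) \<times> (nat \<Rightarrow> 'v1) \<Rightarrow> (nat \<Rightarrow> 'u2)) \<Rightarrow> real" where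
  "source_error W p1 p2 h1 h2 n f1 f2 g1 g2 =
     measure_pmf.prob
       (do { u \<leftarrow> iid_pmf n (pair_pmf p1 p2);
             y \<leftarrow> channel_pmf W n (f1 (map_word n fst u)) (f2 (map_word n snd u));
             return_pmf (u, y) })
       {(u, y).
          let u1 = map_word n fst u; u2 = map_word n snd u;
              y1 = map_word n fst y; y2 = map_word n snd y
          in (u1, u2) \<noteq> (g1 (y1, map_word n h2 u2), g2 (y2, map_word n h1 u1))}"

definition reliably_transmissible ::
  "('x1, 'x2, 'y1, 'y2) ichannel \<Rightarrow> 'u1 pmf \<Rightarrow> 'u2 pmf \<Rightarrow> ('u1 \<Rightarrow> 'v1) \<Rightarrow> ('u2 \<Rightarrow> 'v2) \<Rightarrow> bool" where
  "reliably_transmissible W p1 p2 h1 h2 \<longleftrightarrow>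
     (\<exists>f1 f2 g1 g2.
        (\<forall>n. source_code n (f1 n) (f2 n) (g1 n) (g2 n)) \<and>
        (\<lambda>n. source_error W p1 p2 h1 h2 n (f1 n) (f2 n) (g1 n) (g2 n)) \<longlonglongrightarrow> 0)"


section \<open>Interference channel with message side information\<close>

text \<open>The message set \<open>{1, \<dots>, 2\<^bsup>nR\<^esup>}\<close> consists of the positive integers not exceeding \<open>2\<^bsup>nR\<^esup>\<close>.\<close>

definition messages :: "nat \<Rightarrow> real \<Rightarrow> nat set" where
  "messages n R = {1..nat \<lfloor>2 powr (real n * R)\<rfloor>}"

text \<open>
  Encoders map \<open>(W\<^sub>k\<^sub>s, W\<^sub>k\<^sub>p)\<close> to \<open>X\<^sub>k\<^sup>n\<close>; decoder 1 maps \<open>(Y\<^sub>1\<^sup>n, W\<^sub>2\<^sub>s)\<close> to an estimate of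
  \<open>(W\<^sub>1\<^sub>s, W\<^sub>1\<^sub>p)\<close>, and decoder 2 maps \<open>(Y\<^sub>2\<^sup>n, W\<^sub>1\<^sub>s)\<close> to an estimate of \<open>(W\<^sub>2\<^sub>s, W\<^sub>2\<^sub>p)\<close>.
  Rate quadruplets are ordered \<open>(R\<^sub>1\<^sub>s, R\<^sub>1\<^sub>p, R\<^sub>2\<^sub>s, R\<^sub>2\<^sub>p)\<close>.
\<close>

definition channel_code ::
  "nat \<Rightarrow> real \<times> real \<times> real \<times> real
   \<Rightarrow> (nat \<times> nat \<Rightarrow> (nat \<Rightarrow> 'x1)) \<Rightarrow> (nat \<times> nat \<Rightarrow> (nat \<Rightarrow> 'x2))
   \<Rightarrow> ((nat \<Rightarrow> 'y1) \<times> nat \<Rightarrow> nat \<times> nat) \<Rightarrow> ((nat \<Rightarrow> 'y2) \<times> nat \<Rightarrow> nat \<times> nat) \<Rightarrow> bool" where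
  "channel_code n = (\<lambda>(R1s, R1p, R2s, R2p) e1 e2 d1 d2.
     e1 \<in> messages n R1s \<times> messages n R1p \<rightarrow> words n \<and>
     e2 \<in> messages n R2s \<times> messages n R2p \<rightarrow> words n \<and>
     d1 \<in> words n \<times> messages n R2s \<rightarrow> messages n R1s \<times> messages n R1p \<and>
     d2 \<in> words n \<times> messages n R1s \<rightarrow> messages n R2s \<times> messages n R2p)"

definition channel_error ::
  "('x1, 'x2, 'y1, 'y2) ichannel \<Rightarrow> nat \<Rightarrow> real \<times> real \<times> real \<times> real
   \<Rightarrow> (nat \<times> nat \<Rightarrow> (nat \<Rightarrow> 'x1)) \<Rightarrow> (nat \<times> nat \<Rightarrow> (nat \<Rightarrow> 'x2))
   \<Rightarrow> ((nat \<Rightarrow> 'y1) \<times> nat \<Rightarrow> nat \<times> nat) \<Rightarrow> ((nat \<Rightarrow> 'y2) \<times> nat \<Rightarrow> nat \<times> nat) \<Rightarrow> real" where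
  "channel_error W n = (\<lambda>(R1s, R1p, R2s, R2p) e1 e2 d1 d2.
     measure_pmf.prob
       (do { w1s \<leftarrow> pmf_of_set (messages n R1s);
             w1p \<leftarrow> pmf_of_set (messages n R1p);
             w2s \<leftarrow> pmf_of_set (messages n R2s);
             w2p \<leftarrow> pmf_of_set (messages n R2p);
             y \<leftarrow> channel_pmf W n (e1 (w1s, w1p)) (e2 (w2s, w2p));
             return_pmf (w1s, w1p, w2s, w2p, y) })
       {(w1s, w1p, w2s, w2p, y).
          d1 (map_word n fst y, w2s) \<noteq> (w1s, w1p) \<or> d2 (map_word n snd y, w1s) \<noteq> (w2s, w2p)})"

definition achievable ::
  "('x1, 'x2, 'y1, 'y2) ichannel \<Rightarrow> real \<times> real \<times> real \<times> real \<Rightarrow> bool" where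
  "achievable W = (\<lambda>(R1s, R1p, R2s, R2p).
     0 \<le> R1s \<and> 0 \<le> R1p \<and> 0 \<le> R2s \<and> 0 \<le> R2p \<and>
     (\<exists>e1 e2 d1 d2.
        (\<forall>n. channel_code n (R1s, R1p, R2s, R2p) (e1 n) (e2 n) (d1 n) (d2 n)) \<and>
        (\<lambda>n. channel_error W n (R1s, R1p, R2s, R2p) (e1 n) (e2 n) (d1 n) (d2 n)) \<longlonglongrightarrow> 0))"

definition capacity_region ::
  "('x1, 'x2, 'y1, 'y2) ichannel \<Rightarrow> (real \<times> real \<times> real \<times> real) set" where
  "capacity_region W = closure {R. achievable W R}"


section \<open>Entropies in bits\<close>

text \<open>
  Random variables are functions on the probability space of a pmf, and each is given the discrete
  measure on its range, as in the \<open>\<H>(X)\<close> and \<open>\<H>(X | Y)\<close> notation of the locale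
  \<^locale>\<open>information_space\<close>.
\<close>

definition entropy_pmf :: "'a pmf \<Rightarrow> ('a \<Rightarrow> 'b) \<Rightarrow> real" where
  "entropy_pmf p X = prob_space.entropy (measure_pmf p) 2 (count_space (range X)) X"

definition cond_entropy_pmf :: "'a pmf \<Rightarrow> ('a \<Rightarrow> 'b) \<Rightarrow> ('a \<Rightarrow> 'c) \<Rightarrow> real" where
  "cond_entropy_pmf p X Y =
     prob_space.conditional_entropy (measure_pmf p) 2 (count_space (range X)) (count_space (range Y)) X Y"

end

theory Submission
  imports Defs
begin

text \<open>
  Both directions convert codes into codes by labelling source words with messages.

  For achievability, a word \<open>u\<close> with \<open>u\<close> and \<open>h(u)\<close> weakly typical is labelled by an index of \<open>h(u)\<close> (the shared
  message) and an index of \<open>u\<close> within its fibre over \<open>h(u)\<close> (the private message). The labels are not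
  uniform, whereas the channel code is only good on average over uniform messages. Cyclic shifts of the four
  message sets, chosen uniformly at random, make the labels uniform for every source word, so some
  choice of shifts has error at most the average error of the channel code.

  For the converse, the source is uniform on each type class, and by permutation symmetry the map \<open>h\<close> has fibres of
  constant size on it, so a word of the class amounts to two independent uniform indices. As there are only polynomially
  many types, some pair of classes of nearly full exponential size has error at most \<open>2 P\<^sub>e\<close>. Injecting message sets
  of rates slightly below the entropies, again by the best of all shifts, gives a channel code.
\<close>

section \<open>Words and error probabilities\<close>

lemma finite_words [simp]: "finite (words n :: (nat \<Rightarrow> 'a::finite) set)"
  unfolding words_def by (intro finite_PiE) auto

lemma words_nonempty: "words n \<noteq> ({} :: (nat \<Rightarrow> 'a) set)"
  unfolding words_def by (simp add: PiE_eq_empty_iff)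

lemma map_word_in_words [simp]: "map_word n h a \<in> words n"
  by (simp add: words_def map_word_def)

lemma pmf_iid:
  assumes "u \<in> words n"
  shows "pmf (iid_pmf n p) u = (\<Prod>i<n. pmf p (u i))"
  using assms unfolding iid_pmf_def words_def by (subst pmf_Pi') (auto simp: PiE_iff extensional_def)

lemma pmf_iid_outside:
  assumes "u \<notin> words n"
  shows "pmf (iid_pmf n p) u = 0"
  using assms unfolding iid_pmf_def words_def
  by (subst pmf_Pi_outside) (auto simp: PiE_iff extensional_def)

lemma set_iid_pmf: "set_pmf (iid_pmf n p) \<subseteq> words n"
  using pmf_iid_outside by (fastforce simp: set_pmf_iff)

lemma sum_pmf_iid: "(\<Sum>u\<in>words n. pmf (iid_pmf n p) u) = 1" for p :: "'a::finite pmf"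
  by (intro sum_pmf_eq_1 set_iid_pmf finite_words)

text \<open>The side information word is thereby itself i.i.d. with law \<open>map_pmf h p\<close>,
  so its typicality can be judged under its own product law. \<open>map_word\<close> restricts to
  the index set, which produces the default value \<open>undefined\<close> of \<open>Pi_pmf\<close>
  outside it.\<close>

lemma map_pmf_iid:
  "map_pmf (map_word n h) (iid_pmf n p) = iid_pmf n (map_pmf h p)"
proof -
  have "iid_pmf n (map_pmf h p) = Pi_pmf {..<n} undefined (\<lambda>_. p \<bind> (\<lambda>x. return_pmf (h x)))"
    by (simp add: iid_pmf_def map_pmf_def)
  also have "\<dots> = Pi_pmf {..<n} undefined (\<lambda>_. p) \<bind>
      (\<lambda>u. return_pmf (\<lambda>i. if i \<in> {..<n} then h (u i) else undefined))"
    by (subst Pi_pmf_bind[where d' = undefined]) auto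
  also have "\<dots> = map_pmf (map_word n h) (iid_pmf n p)"
    by (simp add: iid_pmf_def map_pmf_def map_word_def restrict_def)
  finally show ?thesis ..
qed

section \<open>Error probabilities as finite sums over words and messages\<close>

lemma measure_bind_pmf_finite:
  fixes f :: "'a \<Rightarrow> 'b pmf"
  assumes "finite S" "set_pmf p \<subseteq> S"
  shows "measure_pmf.prob (p \<bind> f) A = (\<Sum>x\<in>S. pmf p x * measure_pmf.prob (f x) A)"
proof -
  \<comment> \<open>Reading the event as a Boolean random variable turns the measure of a set into a
    pmf at one point, where \<open>pmf_bind\<close> applies.\<close>
  have *: "measure_pmf.prob M A = pmf (map_pmf (\<lambda>x. x \<in> A) M) True" for M :: "'b pmf"
    by (simp add: pmf_map vimage_def)
  have "measure_pmf.prob (p \<bind> f) A = (\<integral>x. measure_pmf.prob (f x) A \<partial>measure_pmf p)"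
    by (simp add: * map_bind_pmf pmf_bind)
  also have "\<dots> = (\<Sum>x\<in>S. pmf p x * measure_pmf.prob (f x) A)"
    using assms by (subst integral_measure_pmf[of S]) auto
  finally show ?thesis .
qed

lemma measure_bind_pmf_of_set:
  fixes f :: "'a \<Rightarrow> 'b pmf"
  assumes "finite S" "S \<noteq> {}"
  shows "measure_pmf.prob (pmf_of_set S \<bind> f) A = (\<Sum>x\<in>S. measure_pmf.prob (f x) A) / card S"
  using assms by (subst measure_bind_pmf_finite[of S]) (auto simp: sum_divide_distrib)

definition unzip_word :: "nat \<Rightarrow> (nat \<Rightarrow> 'a \<times> 'b) \<Rightarrow> (nat \<Rightarrow> 'a) \<times> (nat \<Rightarrow> 'b)" where
  "unzip_word n u = (map_word n fst u, map_word n snd u)"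

lemma bij_betw_unzip_word: "bij_betw (unzip_word n) (words n) (words n \<times> words n)"
proof (rule bij_betw_byWitness[where f' = "\<lambda>(a, b). \<lambda>i\<in>{..<n}. (a i, b i)"])
  show "\<forall>a\<in>words n. (case unzip_word n a of (a, b) \<Rightarrow> \<lambda>i\<in>{..<n}. (a i, b i)) = a"
    by (auto simp: unzip_word_def map_word_def words_def PiE_iff extensional_def fun_eq_iff)
  show "\<forall>a'\<in>words n \<times> words n. unzip_word n (case a' of (a, b) \<Rightarrow> \<lambda>i\<in>{..<n}. (a i, b i)) = a'"
    by (auto simp: unzip_word_def map_word_def words_def PiE_iff extensional_def fun_eq_iff)
  show "unzip_word n ` words n \<subseteq> words n \<times> words n"
    by (simp add: unzip_word_def image_subset_iff)
  show "(\<lambda>(a, b). \<lambda>i\<in>{..<n}. (a i, b i)) ` (words n \<times> words n) \<subseteq> words n"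
    by (intro image_subsetI) (simp add: words_def case_prod_beta')
qed

text \<open>\<open>source_error\<close> draws one word of letter pairs, while the coding arguments
  treat the two users separately. Independence within each letter makes the law of the word of pairs
  factor along the bijection \<open>unzip_word\<close>.\<close>

lemma sum_iid_pair:
  fixes F :: "(nat \<Rightarrow> 'a::finite) \<Rightarrow> (nat \<Rightarrow> 'b::finite) \<Rightarrow> real"
  shows "(\<Sum>u\<in>words n. pmf (iid_pmf n (pair_pmf p q)) u * F (map_word n fst u) (map_word n snd u)) =
    (\<Sum>a\<in>words n. \<Sum>b\<in>words n. pmf (iid_pmf n p) a * pmf (iid_pmf n q) b * F a b)"
proof -
  have "pmf (iid_pmf n (pair_pmf p q)) u =
      pmf (iid_pmf n p) (map_word n fst u) * pmf (iid_pmf n q) (map_word n snd u)"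
    if "u \<in> words n" for u
  proof -
    have "pmf (pair_pmf p q) (u i) = pmf p (fst (u i)) * pmf q (snd (u i))" for i
      by (cases "u i") (simp add: pmf_pair)
    then show ?thesis
      by (simp add: pmf_iid[OF that] pmf_iid[OF map_word_in_words] prod.distrib)
        (simp add: map_word_def)
  qed
  then have "(\<Sum>u\<in>words n. pmf (iid_pmf n (pair_pmf p q)) u * F (map_word n fst u) (map_word n snd u)) =
      (\<Sum>u\<in>words n. (\<lambda>(a, b). pmf (iid_pmf n p) a * pmf (iid_pmf n q) b * F a b) (unzip_word n u))"
    by (simp add: unzip_word_def)
  also have "\<dots> = (\<Sum>(a, b)\<in>words n \<times> words n. pmf (iid_pmf n p) a * pmf (iid_pmf n q) b * F a b)"
    by (rule sum.reindex_bij_betw[OF bij_betw_unzip_word])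
  finally show ?thesis by (simp add: sum.cartesian_product)
qed

text \<open>Conditioning on the two source words leaves only the channel noise random. The code
  conversions compare this quantity with \<open>channel_fail\<close> pointwise, before any
  averaging.\<close>

definition source_fail where
  "source_fail W h1 h2 n f1 f2 g1 g2 u1 u2 =
     measure_pmf.prob (channel_pmf W n (f1 u1) (f2 u2))
       {y. (u1, u2) \<noteq> (g1 (map_word n fst y, map_word n h2 u2), g2 (map_word n snd y, map_word n h1 u1))}"

lemma source_error_eq:
  fixes p1 :: "'u1::finite pmf" and p2 :: "'u2::finite pmf"
  shows "source_error W p1 p2 h1 h2 n f1 f2 g1 g2 =
    (\<Sum>u1\<in>words n. \<Sum>u2\<in>words n. pmf (iid_pmf n p1) u1 * pmf (iid_pmf n p2) u2 *
       source_fail W h1 h2 n f1 f2 g1 g2 u1 u2)"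
  unfolding source_error_def
  apply (subst measure_bind_pmf_finite[OF finite_words set_iid_pmf])
  apply (subst sum_iid_pair[symmetric])
  apply (simp add: source_fail_def Let_def map_pmf_def[symmetric] vimage_def)
  done

definition channel_fail where
  "channel_fail W n e1 e2 d1 d2 w1s w1p w2s w2p =
     measure_pmf.prob (channel_pmf W n (e1 (w1s, w1p)) (e2 (w2s, w2p)))
       {y. d1 (map_word n fst y, w2s) \<noteq> (w1s, w1p) \<or> d2 (map_word n snd y, w1s) \<noteq> (w2s, w2p)}"

lemma finite_messages [simp]: "finite (messages n R)"
  by (simp add: messages_def)

lemma messages_nonempty: "0 \<le> R \<Longrightarrow> messages n R \<noteq> {}"
proof -
  assume "0 \<le> R"
  then have "1 \<le> 2 powr (real n * R)" by (intro ge_one_powr_ge_zero) auto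
  then have "1 \<le> \<lfloor>2 powr (real n * R)\<rfloor>" by simp
  then show ?thesis unfolding messages_def atLeastatMost_empty_iff by linarith
qed

lemma card_messages: "card (messages n R) = nat \<lfloor>2 powr (real n * R)\<rfloor>"
  by (simp add: messages_def)

lemma channel_error_eq:
  assumes "0 \<le> R1s" "0 \<le> R1p" "0 \<le> R2s" "0 \<le> R2p"
  shows "channel_error W n (R1s, R1p, R2s, R2p) e1 e2 d1 d2 =
    (\<Sum>w1s\<in>messages n R1s. \<Sum>w1p\<in>messages n R1p. \<Sum>w2s\<in>messages n R2s. \<Sum>w2p\<in>messages n R2p.
       channel_fail W n e1 e2 d1 d2 w1s w1p w2s w2p) /
    (real (card (messages n R1s)) * real (card (messages n R1p)) *
     real (card (messages n R2s)) * real (card (messages n R2p)))"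
  unfolding channel_error_def prod.case
  by (simp add: measure_bind_pmf_of_set messages_nonempty assms sum_divide_distrib channel_fail_def
      map_pmf_def[symmetric] vimage_def mult_ac)

lemma source_fail_bounds: "0 \<le> source_fail W h1 h2 n f1 f2 g1 g2 u1 u2"
    "source_fail W h1 h2 n f1 f2 g1 g2 u1 u2 \<le> 1"
  by (simp_all add: source_fail_def)

lemma channel_fail_nonneg: "0 \<le> channel_fail W n e1 e2 d1 d2 w1s w1p w2s w2p"
  by (simp add: channel_fail_def)

section \<open>Relabelling by the best shift\<close>

text \<open>Average over the cyclic shifts of \<open>B\<close>: for each fixed \<open>w\<close> the
  shifted label of \<open>m w\<close> runs through \<open>B\<close> exactly once, so the mean over
  all shifts is the right-hand side, and some shift does not exceed the mean. The labels
  \<open>m w\<close> may be distributed in any way.\<close>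

lemma exists_injection_avg_le:
  fixes m :: "'w \<Rightarrow> 'a" and G :: "'w \<Rightarrow> 'b \<Rightarrow> real"
  assumes fin: "finite A" "finite B" and B: "B \<noteq> {}" and card: "card A \<le> card B"
    and m: "m \<in> \<Omega> \<rightarrow> A"
  shows "\<exists>\<sigma>\<in>A \<rightarrow> B. inj_on \<sigma> A \<and>
    (\<Sum>w\<in>\<Omega>. G w (\<sigma> (m w))) \<le> (\<Sum>w\<in>\<Omega>. \<Sum>x\<in>B. G w x) / card B"
proof -
  define N where "N = card B"
  have N: "N > 0" using fin B by (auto simp: N_def card_gt_0_iff)
  obtain \<beta> where \<beta>: "bij_betw \<beta> {0..<N} B"
    using ex_bij_betw_nat_finite[OF fin(2)] by (auto simp: N_def)
  obtain \<alpha> where \<alpha>: "inj_on \<alpha> A" "\<alpha> ` A \<subseteq> {0..<N}"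
    using card_le_inj[OF fin(1), of "{0..<N}"] card by (auto simp: N_def)
  \<comment> \<open>The shift by \<open>b\<close>: \<open>A\<close> is embedded in the residues
    modulo \<open>N\<close> by \<open>\<alpha>\<close>, rotated, and read in \<open>B\<close>
    through \<open>\<beta>\<close>.\<close>
  define \<sigma> where "\<sigma> b a = \<beta> ((\<alpha> a + b) mod N)" for b a
  have shift_inj: "inj_on (\<lambda>x. (x + b) mod N) {0..<N}" for b
  proof (rule inj_onI)
    have le: "y \<le> x" if "x < N" "y < N" "(x + b) mod N = (y + b) mod N" for x y
    proof (rule ccontr)
      assume "\<not> y \<le> x"
      then have "N dvd y - x" using that(3) mod_eq_dvd_iff_nat[of "x + b" "y + b" N] by simp
      then show False using \<open>\<not> y \<le> x\<close> that nat_dvd_not_less[of "y - x" N] by simp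
    qed
    fix x y assume "x \<in> {0..<N}" "y \<in> {0..<N}" "(x + b) mod N = (y + b) mod N"
    then show "x = y" using le[of x y] le[of y x] by simp
  qed
  have shift_bij: "bij_betw (\<lambda>b. (a + b) mod N) {0..<N} {0..<N}" for a
    using shift_inj[of a] endo_inj_surj[OF _ _ shift_inj[of a]] N
    by (simp add: bij_betw_def add.commute image_subset_iff)
  have into: "\<sigma> b \<in> A \<rightarrow> B" for b
    using \<beta> N by (auto simp: \<sigma>_def bij_betw_def)
  have inj: "inj_on (\<sigma> b) A" for b
  proof (rule inj_onI)
    fix x y assume xy: "x \<in> A" "y \<in> A" "\<sigma> b x = \<sigma> b y"
    then have "(\<alpha> x + b) mod N = (\<alpha> y + b) mod N"
      using inj_onD[OF bij_betw_imp_inj_on[OF \<beta>]] N by (auto simp: \<sigma>_def)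
    then have "\<alpha> x = \<alpha> y"
      using inj_onD[OF shift_inj] xy \<alpha> by blast
    then show "x = y" using inj_onD[OF \<alpha>(1)] xy by auto
  qed
  have "(\<Sum>b\<in>{0..<N}. \<Sum>w\<in>\<Omega>. G w (\<sigma> b (m w))) = (\<Sum>w\<in>\<Omega>. \<Sum>b\<in>{0..<N}. G w (\<sigma> b (m w)))"
    by (rule sum.swap)
  also have "\<dots> = (\<Sum>w\<in>\<Omega>. \<Sum>x\<in>B. G w x)"
  proof (rule sum.cong[OF refl])
    fix w
    have "bij_betw (\<lambda>b. \<sigma> b (m w)) {0..<N} B"
      using bij_betw_trans[OF shift_bij \<beta>] by (simp add: \<sigma>_def o_def)
    then show "(\<Sum>b\<in>{0..<N}. G w (\<sigma> b (m w))) = (\<Sum>x\<in>B. G w x)"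
      by (rule sum.reindex_bij_betw)
  qed
  finally have total: "(\<Sum>b\<in>{0..<N}. \<Sum>w\<in>\<Omega>. G w (\<sigma> b (m w))) = (\<Sum>w\<in>\<Omega>. \<Sum>x\<in>B. G w x)" .
  have "\<exists>b\<in>{0..<N}. (\<Sum>w\<in>\<Omega>. G w (\<sigma> b (m w))) \<le> (\<Sum>w\<in>\<Omega>. \<Sum>x\<in>B. G w x) / N"
  proof (rule ccontr)
    assume "\<not> ?thesis"
    then have "(\<Sum>b\<in>{0..<N}. (\<Sum>w\<in>\<Omega>. \<Sum>x\<in>B. G w x) / N) < (\<Sum>b\<in>{0..<N}. \<Sum>w\<in>\<Omega>. G w (\<sigma> b (m w)))"
      using N by (intro sum_strict_mono) (force simp: not_le)+
    then show False using N total by simp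
  qed
  then show ?thesis using into inj by (auto simp: N_def)
qed

text \<open>The relabelling is applied to one coordinate at a time, with the sum over the
  coordinates still free as the quantity to be averaged. The weight \<open>q\<close> is the law of
  the source pair when a channel code is given, and constantly 1 when a source code is
  given.\<close>

lemma exists_four_injections_avg_le:
  fixes G :: "'b1 \<Rightarrow> 'b2 \<Rightarrow> 'b3 \<Rightarrow> 'b4 \<Rightarrow> real" and q :: "'w \<Rightarrow> real"
  assumes A: "finite A1" "finite A2" "finite A3" "finite A4"
    and B: "finite B1" "finite B2" "finite B3" "finite B4"
    and ne: "B1 \<noteq> {}" "B2 \<noteq> {}" "B3 \<noteq> {}" "B4 \<noteq> {}"
    and card: "card A1 \<le> card B1" "card A2 \<le> card B2" "card A3 \<le> card B3" "card A4 \<le> card B4"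
    and m: "m1 \<in> \<Omega> \<rightarrow> A1" "m2 \<in> \<Omega> \<rightarrow> A2" "m3 \<in> \<Omega> \<rightarrow> A3" "m4 \<in> \<Omega> \<rightarrow> A4"
  shows "\<exists>\<sigma>1\<in>A1 \<rightarrow> B1. \<exists>\<sigma>2\<in>A2 \<rightarrow> B2. \<exists>\<sigma>3\<in>A3 \<rightarrow> B3. \<exists>\<sigma>4\<in>A4 \<rightarrow> B4.
    inj_on \<sigma>1 A1 \<and> inj_on \<sigma>2 A2 \<and> inj_on \<sigma>3 A3 \<and> inj_on \<sigma>4 A4 \<and>
    (\<Sum>w\<in>\<Omega>. q w * G (\<sigma>1 (m1 w)) (\<sigma>2 (m2 w)) (\<sigma>3 (m3 w)) (\<sigma>4 (m4 w))) \<le>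
    (\<Sum>w\<in>\<Omega>. q w) * ((\<Sum>b1\<in>B1. \<Sum>b2\<in>B2. \<Sum>b3\<in>B3. \<Sum>b4\<in>B4. G b1 b2 b3 b4) /
      (real (card B1) * real (card B2) * real (card B3) * real (card B4)))"
proof -
  obtain \<sigma>1 where s1: "\<sigma>1 \<in> A1 \<rightarrow> B1" "inj_on \<sigma>1 A1" and
    le1: "(\<Sum>w\<in>\<Omega>. q w * (\<Sum>b2\<in>B2. \<Sum>b3\<in>B3. \<Sum>b4\<in>B4. G (\<sigma>1 (m1 w)) b2 b3 b4)) \<le>
     (\<Sum>w\<in>\<Omega>. \<Sum>b1\<in>B1. q w * (\<Sum>b2\<in>B2. \<Sum>b3\<in>B3. \<Sum>b4\<in>B4. G b1 b2 b3 b4)) / card B1"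
    using exists_injection_avg_le[OF A(1) B(1) ne(1) card(1) m(1),
        where G = "\<lambda>w b1. q w * (\<Sum>b2\<in>B2. \<Sum>b3\<in>B3. \<Sum>b4\<in>B4. G b1 b2 b3 b4)"] by auto
  obtain \<sigma>2 where s2: "\<sigma>2 \<in> A2 \<rightarrow> B2" "inj_on \<sigma>2 A2" and
    le2: "(\<Sum>w\<in>\<Omega>. q w * (\<Sum>b3\<in>B3. \<Sum>b4\<in>B4. G (\<sigma>1 (m1 w)) (\<sigma>2 (m2 w)) b3 b4)) \<le>
     (\<Sum>w\<in>\<Omega>. \<Sum>b2\<in>B2. q w * (\<Sum>b3\<in>B3. \<Sum>b4\<in>B4. G (\<sigma>1 (m1 w)) b2 b3 b4)) / card B2"
    using exists_injection_avg_le[OF A(2) B(2) ne(2) card(2) m(2),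
        where G = "\<lambda>w b2. q w * (\<Sum>b3\<in>B3. \<Sum>b4\<in>B4. G (\<sigma>1 (m1 w)) b2 b3 b4)"] by auto
  obtain \<sigma>3 where s3: "\<sigma>3 \<in> A3 \<rightarrow> B3" "inj_on \<sigma>3 A3" and
    le3: "(\<Sum>w\<in>\<Omega>. q w * (\<Sum>b4\<in>B4. G (\<sigma>1 (m1 w)) (\<sigma>2 (m2 w)) (\<sigma>3 (m3 w)) b4)) \<le>
     (\<Sum>w\<in>\<Omega>. \<Sum>b3\<in>B3. q w * (\<Sum>b4\<in>B4. G (\<sigma>1 (m1 w)) (\<sigma>2 (m2 w)) b3 b4)) / card B3"
    using exists_injection_avg_le[OF A(3) B(3) ne(3) card(3) m(3),
        where G = "\<lambda>w b3. q w * (\<Sum>b4\<in>B4. G (\<sigma>1 (m1 w)) (\<sigma>2 (m2 w)) b3 b4)"] by auto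
  obtain \<sigma>4 where s4: "\<sigma>4 \<in> A4 \<rightarrow> B4" "inj_on \<sigma>4 A4" and
    le4: "(\<Sum>w\<in>\<Omega>. q w * G (\<sigma>1 (m1 w)) (\<sigma>2 (m2 w)) (\<sigma>3 (m3 w)) (\<sigma>4 (m4 w))) \<le>
     (\<Sum>w\<in>\<Omega>. \<Sum>b4\<in>B4. q w * G (\<sigma>1 (m1 w)) (\<sigma>2 (m2 w)) (\<sigma>3 (m3 w)) b4) / card B4"
    using exists_injection_avg_le[OF A(4) B(4) ne(4) card(4) m(4),
        where G = "\<lambda>w b4. q w * G (\<sigma>1 (m1 w)) (\<sigma>2 (m2 w)) (\<sigma>3 (m3 w)) b4"] by auto
  let ?S1 = "\<Sum>w\<in>\<Omega>. q w * (\<Sum>b2\<in>B2. \<Sum>b3\<in>B3. \<Sum>b4\<in>B4. G (\<sigma>1 (m1 w)) b2 b3 b4)"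
  let ?S2 = "\<Sum>w\<in>\<Omega>. q w * (\<Sum>b3\<in>B3. \<Sum>b4\<in>B4. G (\<sigma>1 (m1 w)) (\<sigma>2 (m2 w)) b3 b4)"
  let ?S3 = "\<Sum>w\<in>\<Omega>. q w * (\<Sum>b4\<in>B4. G (\<sigma>1 (m1 w)) (\<sigma>2 (m2 w)) (\<sigma>3 (m3 w)) b4)"
  let ?S4 = "\<Sum>w\<in>\<Omega>. q w * G (\<sigma>1 (m1 w)) (\<sigma>2 (m2 w)) (\<sigma>3 (m3 w)) (\<sigma>4 (m4 w))"
  let ?S0 = "(\<Sum>b1\<in>B1. \<Sum>b2\<in>B2. \<Sum>b3\<in>B3. \<Sum>b4\<in>B4. G b1 b2 b3 b4)"
  \<comment> \<open>Once the first coordinate is averaged, the inner sum no longer depends on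
    \<open>w\<close>, so the total weight of \<open>q\<close> factors out.\<close>
  have le1': "?S1 \<le> (\<Sum>w\<in>\<Omega>. q w) * ?S0 / card B1"
    using le1 by (simp only: sum_distrib_left[symmetric] sum_distrib_right[symmetric])
  have le2': "?S2 \<le> ?S1 / card B2" using le2 by (simp only: sum_distrib_left[symmetric])
  have le3': "?S3 \<le> ?S2 / card B3" using le3 by (simp only: sum_distrib_left[symmetric])
  have le4': "?S4 \<le> ?S3 / card B4" using le4 by (simp only: sum_distrib_left[symmetric])
  have "?S4 \<le> ?S3 / card B4" by (rule le4')
  also have "\<dots> \<le> (?S2 / card B3) / card B4" by (intro divide_right_mono le3') simp
  also have "\<dots> \<le> (?S1 / card B2) / card B3 / card B4" by (intro divide_right_mono le2') simp_all
  also have "\<dots> \<le> (\<Sum>w\<in>\<Omega>. q w) * ?S0 / card B1 / card B2 / card B3 / card B4"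
    by (intro divide_right_mono le1') simp_all
  also have "\<dots> = (\<Sum>w\<in>\<Omega>. q w) * (?S0 / (real (card B1) * real (card B2) * real (card B3) * real (card B4)))"
    by (simp add: mult_ac)
  finally show ?thesis using s1 s2 s3 s4 by blast
qed

section \<open>Entropy and typical words\<close>

text \<open>A finite-sum form of the entropy that depends on the law alone; the library entropies
  are reduced to it. Letters of probability 0 contribute 0 through their factor.\<close>

definition shannon :: "'a::finite pmf \<Rightarrow> real" where
  "shannon p = - (\<Sum>x\<in>UNIV. pmf p x * log 2 (pmf p x))"

lemma information_space_pmf: "information_space (measure_pmf p) 2"
  by unfold_locales simp

lemma simple_function_pmf: "finite (range f) \<Longrightarrow> simple_function (measure_pmf p) f"
  by (simp add: simple_function_def)

lemma entropy_pmf_eq: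
  fixes X :: "'a \<Rightarrow> 'b::finite"
  shows "entropy_pmf p X = shannon (map_pmf X p)"
proof -
  interpret information_space "measure_pmf p" 2 by (rule information_space_pmf)
  have "entropy_pmf p X = - (\<Sum>x\<in>range X. measure_pmf.prob p (X -` {x}) * log 2 (measure_pmf.prob p (X -` {x})))"
    unfolding entropy_pmf_def
    using entropy_simple_distributed[OF measure_pmf.simple_distributedI[OF simple_function_pmf measure_nonneg refl], of X]
    by simp
  also have "\<dots> = - (\<Sum>x\<in>UNIV. measure_pmf.prob p (X -` {x}) * log 2 (measure_pmf.prob p (X -` {x})))"
  proof (intro arg_cong[where f = uminus] sum.mono_neutral_left ballI)
    fix i assume "i \<in> UNIV - range X"
    then have "X -` {i} = {}" by auto
    then show "measure_pmf.prob p (X -` {i}) * log 2 (measure_pmf.prob p (X -` {i})) = 0" by simp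
  qed auto
  finally show ?thesis by (simp add: shannon_def pmf_map)
qed

text \<open>The chain rule, in which the joint entropy is that of \<open>U\<close> alone because
  \<open>h(U)\<close> is a function of \<open>U\<close>.\<close>

lemma cond_entropy_pmf_eq:
  fixes p :: "'a::finite pmf" and h :: "'a \<Rightarrow> 'b::finite"
  shows "cond_entropy_pmf p (\<lambda>u. u) h = shannon p - shannon (map_pmf h p)"
proof -
  interpret information_space "measure_pmf p" 2 by (rule information_space_pmf)
  have "entropy_pmf p (\<lambda>u. u) = entropy_pmf p h + cond_entropy_pmf p (\<lambda>u. u) h"
    using entropy_partition[OF simple_function_pmf, of "\<lambda>u. u" h]
    by (simp add: entropy_pmf_def cond_entropy_pmf_def o_def)
  then show ?thesis by (simp add: entropy_pmf_eq map_pmf_ident)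
qed

lemma cond_entropy_pmf_nonneg:
  fixes p :: "'a::finite pmf" and h :: "'a \<Rightarrow> 'b::finite"
  shows "0 \<le> cond_entropy_pmf p (\<lambda>u. u) h"
proof -
  interpret information_space "measure_pmf p" 2 by (rule information_space_pmf)
  show ?thesis
    using conditional_entropy_nonneg[OF simple_function_pmf simple_function_pmf, of "\<lambda>u. u" h]
    by (simp add: cond_entropy_pmf_def)
qed

lemma shannon_nonneg: "0 \<le> shannon p"
proof -
  have "pmf p x * log 2 (pmf p x) \<le> 0" for x
  proof (cases "pmf p x = 0")
    case False
    then have "log 2 (pmf p x) \<le> 0" by (simp add: less_le pmf_le_1)
    then show ?thesis by (simp add: mult_nonneg_nonpos)
  qed simp
  then show ?thesis by (simp add: shannon_def sum_nonpos)
qed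

section \<open>Weak typicality and its concentration\<close>

definition typical :: "nat \<Rightarrow> real \<Rightarrow> 'a::finite pmf \<Rightarrow> (nat \<Rightarrow> 'a) set" where
  "typical n \<epsilon> p = {u \<in> words n. 2 powr (- real n * (shannon p + \<epsilon>)) \<le> pmf (iid_pmf n p) u \<and>
     pmf (iid_pmf n p) u \<le> 2 powr (- real n * (shannon p - \<epsilon>))}"

text \<open>This is the asymptotic equipartition property. The self-informations
  \<open>f (u i)\<close> of the letters are i.i.d. and bounded with mean \<open>shannon p\<close>,
  so Hoeffding's inequality gives an exponentially small probability of deviation.\<close>

lemma typical_probability:
  fixes p :: "'a::finite pmf"
  assumes \<epsilon>: "0 < \<epsilon>"
  shows "(\<lambda>n. measure_pmf.prob (iid_pmf n p) (- typical n \<epsilon> p)) \<longlonglongrightarrow> 0"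
proof -
  define f where "f x = - log 2 (pmf p x)" for x
  \<comment> \<open>The summand 1 keeps \<open>B\<close> positive, so that the interval from
    \<open>-B\<close> to \<open>B\<close> has positive length even if every \<open>f x\<close> is
    0.\<close>
  define B where "B = 1 + (\<Sum>x\<in>UNIV. \<bar>f x\<bar>)"
  have B: "\<bar>f x\<bar> \<le> B" for x
    using member_le_sum[of x UNIV "\<lambda>x. \<bar>f x\<bar>"] by (simp add: B_def)
  have "0 < B" unfolding B_def by (intro add_pos_nonneg sum_nonneg) auto
  have bound: "measure_pmf.prob (iid_pmf n p) (- typical n \<epsilon> p) \<le> 2 * exp (-2 * real n * \<epsilon>\<^sup>2 / (B - (-B))\<^sup>2)"
    if n: "n > 0" for n
  proof -
    define P where "P = iid_pmf n p"
    have component: "map_pmf (\<lambda>u. u i) P = p" if "i < n" for i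
      using that unfolding P_def iid_pmf_def by (subst Pi_pmf_component) auto
    interpret Hoeffding_ineq_iid P "{..<n}" "\<lambda>i u. f (u i)" "\<lambda>u. f (u 0)" "-B" B "shannon p"
    proof unfold_locales
      show "prob_space.indep_vars P (\<lambda>_. borel) (\<lambda>i u. f (u i)) {..<n}"
        unfolding P_def iid_pmf_def
        by (rule prob_space.indep_vars_compose2[OF measure_pmf.prob_space_axioms indep_vars_Pi_pmf]) auto
    next
      fix i assume i: "i \<in> {..<n}"
      \<comment> \<open>The Borel law of a real function of the word depends only on its pmf, so it
        suffices to compare the pmfs of two coordinates.\<close>
      have dm: "distr (measure_pmf P) borel g = distr (measure_pmf (map_pmf g P)) borel id" for g :: "(nat \<Rightarrow> 'a) \<Rightarrow> real"
        unfolding map_pmf_rep_eq by (subst distr_distr) (auto simp: o_def)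
      have m: "map_pmf (\<lambda>u. f (u i)) P = map_pmf f p" if "i < n" for i
        using component[OF that] by (simp add: map_pmf_comp[of f "\<lambda>u. u i", symmetric])
      show "distr (measure_pmf P) borel (\<lambda>u. f (u i)) = distr (measure_pmf P) borel (\<lambda>u. f (u 0))"
        using m[of i] m[of 0] i n by (simp add: dm)
    next
      show "AE u in measure_pmf P. f (u 0) \<in> {-B..B}"
        using B by (auto simp: abs_le_iff minus_le_iff)
    next
      have "measure_pmf.expectation P (\<lambda>u. f (u 0)) = measure_pmf.expectation (map_pmf (\<lambda>u. u 0) P) f"
        by simp
      also have "\<dots> = shannon p"
        unfolding component[OF n] by (subst integral_measure_pmf[of UNIV])
          (auto simp: shannon_def f_def sum_negf)
      finally show "shannon p \<equiv> measure_pmf.expectation P (\<lambda>u. f (u 0))" by simp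
    qed auto
    \<comment> \<open>On the support every letter has positive probability, so the probability of
      the word is 2 to the power of minus its total self-information. A word outside the support is
      not typical, which is why the comparison of events below holds only almost everywhere.\<close>
    have "u \<in> typical n \<epsilon> p" if u: "u \<in> set_pmf P" "\<bar>(\<Sum>i<n. f (u i)) / n - shannon p\<bar> < \<epsilon>" for u
    proof -
      have w: "u \<in> words n" using u set_iid_pmf by (auto simp: P_def)
      have "0 < pmf P u" using u by (simp add: pmf_positive)
      then have "0 < pmf p (u i)" if "i < n" for i
        using that unfolding P_def pmf_iid[OF w] by (auto simp: less_le pmf_nonneg)
      then have "pmf P u = (\<Prod>i<n. 2 powr (- f (u i)))"
        unfolding P_def pmf_iid[OF w] by (intro prod.cong) (auto simp: f_def)
      also have "\<dots> = 2 powr (- (\<Sum>i<n. f (u i)))"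
        by (simp add: powr_sum[symmetric] sum_negf)
      finally have eq: "pmf (iid_pmf n p) u = 2 powr (- (\<Sum>i<n. f (u i)))" by (simp add: P_def)
      have "(\<Sum>i<n. f (u i)) / n < shannon p + \<epsilon>" "shannon p - \<epsilon> < (\<Sum>i<n. f (u i)) / n"
        using u(2) by linarith+
      then have "(\<Sum>i<n. f (u i)) < n * (shannon p + \<epsilon>)" "n * (shannon p - \<epsilon>) < (\<Sum>i<n. f (u i))"
        using n by (simp_all add: field_simps)
      then show ?thesis using w by (simp add: typical_def eq)
    qed
    then have "measure_pmf.prob P (- typical n \<epsilon> p) \<le>
        measure_pmf.prob P {u. \<epsilon> \<le> \<bar>(\<Sum>i<n. f (u i)) / n - shannon p\<bar>}"
      by (intro measure_pmf.finite_measure_mono_AE AE_pmfI) (force simp: not_le)+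
    also have "\<dots> \<le> 2 * exp (-2 * real n * \<epsilon>\<^sup>2 / (B - (-B))\<^sup>2)"
      using Hoeffding_ineq_abs_ge'[of \<epsilon>] \<epsilon> n \<open>0 < B\<close> by (auto simp: lessThan_empty_iff)
    finally show ?thesis by (simp add: P_def)
  qed
  define c where "c = 2 * \<epsilon>\<^sup>2 / (B - (-B))\<^sup>2"
  have "0 < c" using \<epsilon> \<open>0 < B\<close> by (simp add: c_def)
  then have "(\<lambda>n. 2 * exp (- c) ^ n) \<longlonglongrightarrow> 2 * 0"
    by (intro tendsto_intros LIMSEQ_realpow_zero) auto
  moreover have "2 * exp (-2 * real n * \<epsilon>\<^sup>2 / (B - (-B))\<^sup>2) = 2 * exp (- c) ^ n" for n :: nat
    by (simp add: c_def exp_of_nat_mult[symmetric] mult_ac)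
  ultimately have "(\<lambda>n. 2 * exp (-2 * real n * \<epsilon>\<^sup>2 / (B - (-B))\<^sup>2)) \<longlonglongrightarrow> 0" by simp
  moreover have "\<forall>\<^sub>F n in sequentially. norm (measure_pmf.prob (iid_pmf n p) (- typical n \<epsilon> p)) \<le>
      2 * exp (-2 * real n * \<epsilon>\<^sup>2 / (B - (-B))\<^sup>2)"
    using bound by (intro eventually_sequentiallyI[of 1]) simp
  ultimately show ?thesis by (rule Lim_null_comparison[rotated])
qed

text \<open>Typicality of both the word and its image bounds the number of images and the size of
  each fibre; these two counts correspond to the shared and the private rate.\<close>

definition jointly_typical :: "nat \<Rightarrow> real \<Rightarrow> 'a::finite pmf \<Rightarrow> ('a \<Rightarrow> 'b::finite) \<Rightarrow> (nat \<Rightarrow> 'a) set" where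
  "jointly_typical n \<epsilon> p h = {u \<in> typical n \<epsilon> p. map_word n h u \<in> typical n \<epsilon> (map_pmf h p)}"

lemma jointly_typical_subset: "jointly_typical n \<epsilon> p h \<subseteq> words n"
  by (auto simp: jointly_typical_def typical_def)

lemma finite_jointly_typical [simp]: "finite (jointly_typical n \<epsilon> p h)"
  using finite_subset[OF jointly_typical_subset finite_words] .

text \<open>A union bound: either the word or its image is atypical, and the image is an i.i.d. word
  as well.\<close>

lemma jointly_typical_probability:
  fixes p :: "'a::finite pmf" and h :: "'a \<Rightarrow> 'b::finite"
  assumes "0 < \<epsilon>"
  shows "(\<lambda>n. measure_pmf.prob (iid_pmf n p) (- jointly_typical n \<epsilon> p h)) \<longlonglongrightarrow> 0"
proof -
  have le: "norm (measure_pmf.prob (iid_pmf n p) (- jointly_typical n \<epsilon> p h)) \<le>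
      measure_pmf.prob (iid_pmf n p) (- typical n \<epsilon> p) +
      measure_pmf.prob (iid_pmf n (map_pmf h p)) (- typical n \<epsilon> (map_pmf h p))" for n
  proof -
    have "- jointly_typical n \<epsilon> p h = - typical n \<epsilon> p \<union> map_word n h -` (- typical n \<epsilon> (map_pmf h p))"
      by (auto simp: jointly_typical_def)
    then have "measure_pmf.prob (iid_pmf n p) (- jointly_typical n \<epsilon> p h) \<le>
        measure_pmf.prob (iid_pmf n p) (- typical n \<epsilon> p) +
        measure_pmf.prob (iid_pmf n p) (map_word n h -` (- typical n \<epsilon> (map_pmf h p)))"
      by (simp add: measure_Un_le)
    then show ?thesis by (simp add: map_pmf_iid[symmetric] del: vimage_Compl)
  qed
  have lim: "(\<lambda>n. measure_pmf.prob (iid_pmf n p) (- typical n \<epsilon> p) +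
      measure_pmf.prob (iid_pmf n (map_pmf h p)) (- typical n \<epsilon> (map_pmf h p))) \<longlonglongrightarrow> 0 + 0"
    by (intro tendsto_add typical_probability assms)
  show ?thesis
    by (rule Lim_null_comparison[OF always_eventually[OF allI[OF le]] lim[unfolded add_0_left]])
qed

section \<open>Counting jointly typical words and indexing them by messages\<close>

lemma card_mult_le_prob:
  assumes "finite A" "\<And>x. x \<in> A \<Longrightarrow> c \<le> pmf P x"
  shows "real (card A) * c \<le> measure_pmf.prob P A"
  unfolding measure_measure_pmf_finite[OF assms(1)] by (rule sum_bounded_below) (rule assms(2))

lemma prob_le_card_mult:
  assumes "finite A" "\<And>x. x \<in> A \<Longrightarrow> pmf P x \<le> c"
  shows "measure_pmf.prob P A \<le> real (card A) * c"
  unfolding measure_measure_pmf_finite[OF assms(1)] by (rule sum_bounded_above) (rule assms(2))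

lemma le_mult_powr_if:
  fixes a b x :: real
  assumes "a * 2 powr (- real n * x) \<le> b"
  shows "a \<le> b * 2 powr (real n * x)"
proof -
  have "a = (a * 2 powr (- real n * x)) * 2 powr (real n * x)"
    by (simp add: mult.assoc powr_add[symmetric])
  also have "\<dots> \<le> b * 2 powr (real n * x)" by (intro mult_right_mono assms) simp
  finally show ?thesis .
qed

lemma mult_powr_le_if:
  fixes a b x :: real
  assumes "a \<le> b * 2 powr (- real n * x)"
  shows "a * 2 powr (real n * x) \<le> b"
proof -
  have "a * 2 powr (real n * x) \<le> (b * 2 powr (- real n * x)) * 2 powr (real n * x)"
    by (intro mult_right_mono assms) simp
  also have "\<dots> = b" by (simp add: mult.assoc powr_add[symmetric])
  finally show ?thesis .
qed

text \<open>Each image is typical and hence has a probability bounded below, while all of them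
  together have at most 1. The subset \<open>T\<close> is left free because the bound serves both
  the full typical set and single type classes.\<close>

lemma card_image_jointly_typical_le:
  fixes h :: "'a::finite \<Rightarrow> 'b::finite"
  assumes "T \<subseteq> jointly_typical n \<epsilon> p h"
  shows "real (card (map_word n h ` T)) \<le> 2 powr (n * (shannon (map_pmf h p) + \<epsilon>))"
proof -
  have "finite (map_word n h ` T)" using finite_subset[OF assms] by simp
  then have "real (card (map_word n h ` T)) * 2 powr (- real n * (shannon (map_pmf h p) + \<epsilon>)) \<le>
      measure_pmf.prob (iid_pmf n (map_pmf h p)) (map_word n h ` T)"
    using assms by (intro card_mult_le_prob) (auto simp: jointly_typical_def typical_def)
  also have "\<dots> \<le> 1" by simp
  finally show ?thesis using le_mult_powr_if by fastforce
qed

text \<open>The words over \<open>v\<close> have together at most the probability of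
  \<open>v\<close>, which typicality of \<open>v\<close> bounds above, and each has at least the
  probability that its own typicality guarantees. Each of the two bounds costs one
  \<open>\<epsilon>\<close>.\<close>

lemma card_fibre_jointly_typical_le:
  fixes h :: "'a::finite \<Rightarrow> 'b::finite"
  shows "real (card {u \<in> jointly_typical n \<epsilon> p h. map_word n h u = v}) \<le>
    2 powr (n * (shannon p - shannon (map_pmf h p) + 2 * \<epsilon>))"
proof (cases "{u \<in> jointly_typical n \<epsilon> p h. map_word n h u = v} = {}")
  case False
  let ?F = "{u \<in> jointly_typical n \<epsilon> p h. map_word n h u = v}"
  have v: "v \<in> typical n \<epsilon> (map_pmf h p)" using False by (auto simp: jointly_typical_def)
  have "real (card ?F) * 2 powr (- real n * (shannon p + \<epsilon>)) \<le> measure_pmf.prob (iid_pmf n p) ?F"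
    by (intro card_mult_le_prob) (auto simp: jointly_typical_def typical_def)
  also have "\<dots> \<le> measure_pmf.prob (iid_pmf n p) (map_word n h -` {v})"
    by (intro measure_pmf.finite_measure_mono) auto
  also have "\<dots> = pmf (iid_pmf n (map_pmf h p)) v"
    by (simp add: map_pmf_iid[symmetric] pmf_map)
  also have "\<dots> \<le> 2 powr (- real n * (shannon (map_pmf h p) - \<epsilon>))"
    using v by (simp add: typical_def)
  finally have "real (card ?F) \<le>
      2 powr (- real n * (shannon (map_pmf h p) - \<epsilon>)) * 2 powr (n * (shannon p + \<epsilon>))"
    by (rule le_mult_powr_if)
  also have "\<dots> = 2 powr (n * (shannon p - shannon (map_pmf h p) + 2 * \<epsilon>))"
    by (simp add: powr_add[symmetric] algebra_simps)
  finally show ?thesis .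
next
  case True
  then show ?thesis by (simp only: card.empty of_nat_0 powr_ge_zero)
qed

lemma le_card_messages: "real m \<le> 2 powr (real n * R) \<Longrightarrow> m \<le> card (messages n R)"
  unfolding card_messages by linarith

lemma card_messages_le: "real (card (messages n R)) \<le> 2 powr (real n * R)"
  unfolding card_messages by (rule of_nat_floor) simp

text \<open>The index \<open>s\<close> separates the images and \<open>t\<close> separates the words
  within each fibre, so together they determine a jointly typical word. The shared index is a
  function of the image alone, so a receiver holding the side information can compute it.\<close>

lemma exists_source_indexing:
  fixes p :: "'a::finite pmf" and h :: "'a \<Rightarrow> 'b::finite"
  assumes Rs: "shannon (map_pmf h p) + \<epsilon> \<le> Rs" and Rp: "shannon p - shannon (map_pmf h p) + 2 * \<epsilon> \<le> Rp"
    and nonneg: "0 \<le> Rs" "0 \<le> Rp"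
  shows "\<exists>s\<in>UNIV \<rightarrow> messages n Rs. \<exists>t\<in>UNIV \<rightarrow> messages n Rp.
    inj_on (\<lambda>u. (s (map_word n h u), t u)) (jointly_typical n \<epsilon> p h)"
proof -
  let ?J = "jointly_typical n \<epsilon> p h"
  \<comment> \<open>Elements outside \<open>A\<close> all receive one fixed message, so that the
    index is a total function.\<close>
  have extend: "\<exists>f\<in>UNIV \<rightarrow> messages n R. inj_on f A"
    if A: "finite A" "real (card A) \<le> 2 powr (real n * R)" and "0 \<le> R" for A :: "'c set" and R
  proof -
    obtain f where f: "f \<in> A \<rightarrow> messages n R" "inj_on f A"
      using card_le_inj[OF A(1) finite_messages le_card_messages[OF A(2)]] by blast
    obtain z where z: "z \<in> messages n R" using messages_nonempty[OF \<open>0 \<le> R\<close>] by blast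
    have "(\<lambda>x. if x \<in> A then f x else z) \<in> UNIV \<rightarrow> messages n R" using f z by auto
    moreover have "inj_on (\<lambda>x. if x \<in> A then f x else z) A" using f by (auto simp: inj_on_def)
    ultimately show ?thesis by blast
  qed
  have "real (card (map_word n h ` ?J)) \<le> 2 powr (n * (shannon (map_pmf h p) + \<epsilon>))"
    by (intro card_image_jointly_typical_le) simp
  also have "\<dots> \<le> 2 powr (n * Rs)" using Rs by (intro powr_mono mult_left_mono) auto
  finally obtain s where s: "s \<in> UNIV \<rightarrow> messages n Rs" "inj_on s (map_word n h ` ?J)"
    using extend[of "map_word n h ` ?J" Rs] nonneg by auto
  have "\<exists>t\<in>UNIV \<rightarrow> messages n Rp. inj_on t {u \<in> ?J. map_word n h u = v}" for v
  proof (rule extend)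
    have "real (card {u \<in> ?J. map_word n h u = v}) \<le> 2 powr (n * (shannon p - shannon (map_pmf h p) + 2 * \<epsilon>))"
      by (rule card_fibre_jointly_typical_le)
    also have "\<dots> \<le> 2 powr (n * Rp)" using Rp by (intro powr_mono mult_left_mono) auto
    finally show "real (card {u \<in> ?J. map_word n h u = v}) \<le> 2 powr (n * Rp)" .
  qed (use nonneg in auto)
  then have "\<forall>v. \<exists>t. t \<in> UNIV \<rightarrow> messages n Rp \<and> inj_on t {u \<in> ?J. map_word n h u = v}" by blast
  from choice[OF this] obtain t where t: "\<And>v. t v \<in> UNIV \<rightarrow> messages n Rp"
      "\<And>v. inj_on (t v) {u \<in> ?J. map_word n h u = v}"
    by blast
  have "inj_on (\<lambda>u. (s (map_word n h u), t (map_word n h u) u)) ?J"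
  proof (rule inj_onI)
    fix u u' assume u: "u \<in> ?J" "u' \<in> ?J"
      and eq: "(s (map_word n h u), t (map_word n h u) u) = (s (map_word n h u'), t (map_word n h u') u')"
    then have "map_word n h u = map_word n h u'"
      using inj_onD[OF s(2), of "map_word n h u" "map_word n h u'"] by simp
    then show "u = u'" using inj_onD[OF t(2)[of "map_word n h u"], of u u'] eq u by simp
  qed
  then show ?thesis using s(1) t(1) by (intro bexI[of _ s] bexI[of _ "\<lambda>u. t (map_word n h u) u"]) auto
qed

section \<open>Type classes\<close>

text \<open>The type is kept as a multiset of letters instead of a vector of frequencies, so that
  the probability of a word and the type of its image are both obtained by
  \<open>image_mset\<close>.\<close>

definition word_type :: "nat \<Rightarrow> (nat \<Rightarrow> 'a) \<Rightarrow> 'a multiset" where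
  "word_type n u = image_mset u (mset_set {..<n})"

lemma pmf_iid_word_type:
  assumes "u \<in> words n"
  shows "pmf (iid_pmf n p) u = prod_mset (image_mset (pmf p) (word_type n u))"
  by (simp add: pmf_iid[OF assms] word_type_def prod_unfold_prod_mset image_mset.compositionality o_def)

lemma word_type_map_word: "word_type n (map_word n h u) = image_mset h (word_type n u)"
  unfolding word_type_def image_mset.compositionality
  by (intro image_mset_cong) (auto simp: map_word_def)

text \<open>The probabilities of a word and of its image are functions of the type, so joint
  typicality holds for all or none of a type class.\<close>

lemma jointly_typical_word_type:
  assumes "u \<in> jointly_typical n \<epsilon> p h" "u' \<in> words n" "word_type n u' = word_type n u"
  shows "u' \<in> jointly_typical n \<epsilon> p h"
  using assms by (auto simp: jointly_typical_def typical_def pmf_iid_word_type word_type_map_word)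

text \<open>The letter counts determine the type, and each takes one of the values from 0 to
  \<open>n\<close>. What matters is that the bound is polynomial in \<open>n\<close>.\<close>

lemma card_word_types:
  "card (word_type n ` (words n :: (nat \<Rightarrow> 'a::finite) set)) \<le> (n + 1) ^ CARD('a)"
proof -
  have "count ` word_type n ` (words n :: (nat \<Rightarrow> 'a) set) \<subseteq> (UNIV \<rightarrow>\<^sub>E {..n})"
  proof (clarsimp simp: PiE_UNIV_domain)
    fix u :: "nat \<Rightarrow> 'a" and x
    have "count (word_type n u) x \<le> size (word_type n u)" by (rule count_le_size)
    then show "count (word_type n u) x \<le> n" by (simp add: word_type_def)
  qed
  moreover have fin: "finite ((UNIV :: 'a set) \<rightarrow>\<^sub>E {..n})" by (intro finite_PiE) auto
  ultimately have "card (count ` word_type n ` (words n :: (nat \<Rightarrow> 'a) set)) \<le> card ((UNIV :: 'a set) \<rightarrow>\<^sub>E {..n})"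
    by (intro card_mono)
  then show ?thesis
    by (simp add: card_image inj_on_def count_inject card_PiE)
qed

text \<open>Words of equal type differ by a permutation of positions. Applying that permutation
  keeps the type of every word and carries the words over the image of \<open>u\<close> injectively
  to words over the image of \<open>u'\<close>. Exchanging \<open>u\<close> and \<open>u'\<close>
  gives equality.\<close>

lemma card_type_fibre_le:
  fixes u u' :: "nat \<Rightarrow> 'a::finite"
  assumes "word_type n u = word_type n u'"
  shows "card {w \<in> words n. word_type n w = M \<and> map_word n h w = map_word n h u} \<le>
    card {w \<in> words n. word_type n w = M \<and> map_word n h w = map_word n h u'}"
proof -
  obtain \<pi> where \<pi>: "\<pi> permutes {..<n}" "\<forall>i\<in>{..<n}. u' i = u (\<pi> i)"
    using image_mset_eq_implies_permutes[of "{..<n}" u' u] assms by (auto simp: word_type_def)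
  have lt: "\<pi> i < n \<longleftrightarrow> i < n" for i using permutes_in_image[OF \<pi>(1), of i] by simp
  \<comment> \<open>This is \<open>w\<close> rearranged by \<open>\<pi>\<close>: with
    \<open>w \<circ> \<pi>\<close> as letter map and \<open>id\<close> as word,
    \<open>map_word\<close> performs the restriction to the index set.\<close>
  let ?r = "\<lambda>w :: nat \<Rightarrow> 'a. map_word n (w \<circ> \<pi>) id"
  have "inj_on ?r (words n)"
  proof (rule inj_onI)
    fix w w' :: "nat \<Rightarrow> 'a" assume w: "w \<in> words n" "w' \<in> words n" "?r w = ?r w'"
    have "w i = w' i" if "i < n" for i
    proof -
      have "inv \<pi> i < n" "\<pi> (inv \<pi> i) = i"
        using that \<pi>(1) lt[of "inv \<pi> i"] permutes_inverses(1)[OF \<pi>(1)] by auto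
      then show ?thesis using fun_cong[OF w(3), of "inv \<pi> i"] by (simp add: map_word_def)
    qed
    then show "w = w'" using PiE_ext[of w "{..<n}" "\<lambda>_. UNIV" w'] w(1,2) by (simp add: words_def)
  qed
  then have "inj_on ?r {w \<in> words n. word_type n w = M \<and> map_word n h w = map_word n h u}"
    by (rule inj_on_subset) auto
  moreover have "?r ` {w \<in> words n. word_type n w = M \<and> map_word n h w = map_word n h u} \<subseteq>
      {w \<in> words n. word_type n w = M \<and> map_word n h w = map_word n h u'}"
  proof clarify
    fix w :: "nat \<Rightarrow> 'a" assume w: "w \<in> words n" "map_word n h w = map_word n h u"
    have "word_type n (?r w) = image_mset w (image_mset \<pi> (mset_set {..<n}))"
      unfolding word_type_def image_mset.compositionality
      by (intro image_mset_cong) (auto simp: map_word_def)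
    also have "image_mset \<pi> (mset_set {..<n}) = mset_set {..<n}"
      by (simp add: image_mset_mset_set[OF permutes_inj_on[OF \<pi>(1)]] permutes_image[OF \<pi>(1)])
    finally have "word_type n (?r w) = word_type n w" by (simp only: word_type_def)
    moreover have "h (w (\<pi> i)) = h (u' i)" if "i < n" for i
      using fun_cong[OF w(2), of "\<pi> i"] that \<pi>(2) lt[of i] by (simp add: map_word_def)
    then have "map_word n h (?r w) = map_word n h u'"
      by (auto simp: map_word_def fun_eq_iff)
    ultimately show "?r w \<in> words n \<and> word_type n (?r w) = word_type n w \<and> map_word n h (?r w) = map_word n h u'"
      by simp
  qed
  ultimately show ?thesis by (intro card_inj_on_le) auto
qed

text \<open>
  On a type class the source is uniform, and so are the private indices \<open>j < k\<close> given the side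
  information \<open>v\<close>; this makes the source word \<open>L (v, j)\<close> a function of two independent uniform messages.
\<close>

definition uniform_block ::
  "nat \<Rightarrow> 'a pmf \<Rightarrow> ('a \<Rightarrow> 'b) \<Rightarrow> nat \<Rightarrow> nat \<Rightarrow> (nat \<Rightarrow> 'a) set \<Rightarrow> bool" where
  "uniform_block n p h ms mp T \<longleftrightarrow> T \<noteq> {} \<and> T \<subseteq> words n \<and>
     (\<exists>c>0. \<forall>u\<in>T. pmf (iid_pmf n p) u = c) \<and>
     (\<exists>k L. bij_betw L (map_word n h ` T \<times> {..<k::nat}) T \<and>
        (\<forall>v\<in>map_word n h ` T. \<forall>j<k. map_word n h (L (v, j)) = v) \<and>
        ms \<le> card (map_word n h ` T) \<and> mp \<le> k)"

text \<open>All fibres of the image map on a type class have the same size \<open>k\<close>, so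
  numbering each of them gives \<open>L\<close>. Since the class has \<open>k\<close> times as many
  words as images, the product bound on \<open>mp\<close> yields \<open>mp \<le> k\<close>.\<close>

lemma uniform_block_type_class:
  fixes p :: "'a::finite pmf" and h :: "'a \<Rightarrow> 'b::finite"
  assumes T: "T = {w \<in> words n. word_type n w = M}" and "u \<in> T"
    and pos: "0 < pmf (iid_pmf n p) u"
    and ms: "ms \<le> card (map_word n h ` T)" and mp: "mp * card (map_word n h ` T) \<le> card T"
  shows "uniform_block n p h ms mp T"
proof -
  define fibre where "fibre v = {w \<in> T. map_word n h w = v}" for v
  define k where "k = card (fibre (map_word n h u))"
  have finT: "finite T" using T by simp
  have card_fibre: "card (fibre v) = k" if "v \<in> map_word n h ` T" for v
  proof -
    obtain w where w: "w \<in> T" "v = map_word n h w" using \<open>v \<in> _\<close> by blast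
    have "word_type n w = word_type n u" using w \<open>u \<in> T\<close> T by auto
    then show ?thesis
      using card_type_fibre_le[of n w u M h] card_type_fibre_le[of n u w M h] w
      by (simp add: fibre_def k_def T conj_assoc)
  qed
  have "\<exists>\<beta>. bij_betw \<beta> {..<k} (fibre v)" if "v \<in> map_word n h ` T" for v
    using ex_bij_betw_nat_finite[of "fibre v"] card_fibre[OF that] finT
    by (auto simp: fibre_def atLeast0LessThan)
  then obtain \<beta> where \<beta>: "\<And>v. v \<in> map_word n h ` T \<Longrightarrow> bij_betw (\<beta> v) {..<k} (fibre v)"
    by metis
  have \<beta>_in: "\<beta> v j \<in> fibre v" if "v \<in> map_word n h ` T" "j < k" for v j
    using bij_betwE[OF \<beta>[OF that(1)]] that by auto
  let ?L = "\<lambda>(v, j). \<beta> v j"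
  have "bij_betw ?L (map_word n h ` T \<times> {..<k}) T"
    unfolding bij_betw_def
  proof
    show "inj_on ?L (map_word n h ` T \<times> {..<k})"
    proof (rule inj_onI, clarify)
      fix a b j j' assume a: "a \<in> T" "b \<in> T" "j < k" "j' < k"
        and eq: "\<beta> (map_word n h a) j = \<beta> (map_word n h b) j'"
      have ab: "map_word n h a = map_word n h b"
        using \<beta>_in[of "map_word n h a" j] \<beta>_in[of "map_word n h b" j'] a eq by (auto simp: fibre_def)
      then show "map_word n h a = map_word n h b \<and> j = j'"
        using inj_onD[OF bij_betw_imp_inj_on[OF \<beta>[of "map_word n h a"]]] a eq by auto
    qed
    show "?L ` (map_word n h ` T \<times> {..<k}) = T"
    proof
      show "?L ` (map_word n h ` T \<times> {..<k}) \<subseteq> T"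
        using \<beta>_in by (fastforce simp: fibre_def)
      show "T \<subseteq> ?L ` (map_word n h ` T \<times> {..<k})"
      proof
        fix w assume w: "w \<in> T"
        then have "w \<in> fibre (map_word n h w)" by (simp add: fibre_def)
        then obtain j where "j < k" "w = \<beta> (map_word n h w) j"
          using bij_betw_imp_surj_on[OF \<beta>[of "map_word n h w"]] w by auto
        then show "w \<in> ?L ` (map_word n h ` T \<times> {..<k})" using w by force
      qed
    qed
  qed
  note L_bij = this
  have L_word: "\<forall>v\<in>map_word n h ` T. \<forall>j<k. map_word n h (?L (v, j)) = v"
    using \<beta>_in by (fastforce simp: fibre_def)
  have "mp \<le> k"
  proof -
    have "card T = card (map_word n h ` T) * k"
      using bij_betw_same_card[OF L_bij] by (simp add: card_cartesian_product)
    moreover have "0 < card (map_word n h ` T)" using \<open>u \<in> T\<close> finT by (auto simp: card_gt_0_iff)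
    ultimately show ?thesis using mp by (simp add: mult.commute[of mp])
  qed
  have const: "\<forall>w\<in>T. pmf (iid_pmf n p) w = pmf (iid_pmf n p) u"
    using \<open>u \<in> T\<close> by (auto simp: T pmf_iid_word_type)
  show ?thesis
    unfolding uniform_block_def
  proof (intro conjI exI)
    show "T \<noteq> {}" "T \<subseteq> words n" using \<open>u \<in> T\<close> by (auto simp: T)
  qed (rule pos const L_bij L_word ms \<open>mp \<le> k\<close>)+
qed

section \<open>Type classes of nearly full exponential size\<close>

lemma poly_mult_geometric_tendsto_0:
  fixes c :: real
  assumes "0 < k" "0 < c" "c < 1"
  shows "(\<lambda>n. real (n + 1) ^ k * c ^ n) \<longlonglongrightarrow> 0"
proof -
  \<comment> \<open>With this root the sequence is the \<open>k\<close>-th power of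
    \<open>(n + 1) * d ^ n\<close>, for which the library limit is available.\<close>
  define d where "d = root k c"
  have d: "0 \<le> d" "d < 1" "d ^ k = c" using assms by (simp_all add: d_def)
  have "(\<lambda>n. real n * d ^ n + d ^ n) \<longlonglongrightarrow> 0 + 0"
    using d by (intro tendsto_add powser_times_n_limit_0 LIMSEQ_realpow_zero) auto
  then have "(\<lambda>n. (real n * d ^ n + d ^ n) ^ k) \<longlonglongrightarrow> (0 + 0) ^ k" by (rule tendsto_power)
  moreover have "(real n * d ^ n + d ^ n) ^ k = real (n + 1) ^ k * c ^ n" for n
  proof -
    have "(real n * d ^ n + d ^ n) ^ k = (real (n + 1) * d ^ n) ^ k" by (simp add: algebra_simps)
    also have "\<dots> = real (n + 1) ^ k * (d ^ k) ^ n"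
      by (simp only: power_mult_distrib power_mult[symmetric] mult.commute)
    finally show ?thesis by (simp add: d)
  qed
  ultimately show ?thesis using \<open>0 < k\<close> by (simp add: power_0_left)
qed

text \<open>\<open>S\<close> consists of the jointly typical words whose type class is not too
  improbable. Atypical words cost 1/8 of the mass, and the light classes, being polynomially many,
  cost another 1/8. A heavy class must contain many words and many images because each of these has
  small probability. The alternative of rate 0 covers an entropy that vanishes, below which there is
  no nonnegative rate.\<close>

lemma eventually_exists_uniform_blocks:
  fixes p :: "'a::finite pmf" and h :: "'a \<Rightarrow> 'b::finite"
  assumes Rs: "0 \<le> Rs" "Rs < shannon (map_pmf h p) \<or> Rs = 0"
    and Rp: "0 \<le> Rp" "Rp < shannon p - shannon (map_pmf h p) \<or> Rp = 0"
  shows "\<forall>\<^sub>F n in sequentially. \<exists>S \<subseteq> words n. 3 / 4 \<le> measure_pmf.prob (iid_pmf n p) S \<and>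
    (\<forall>u\<in>S. uniform_block n p h (card (messages n Rs)) (card (messages n Rp))
      {w \<in> S. word_type n w = word_type n u})"
proof -
  let ?Hu = "shannon p" and ?Hv = "shannon (map_pmf h p)"
  \<comment> \<open>The shared rate will lose \<open>2 * \<epsilon>\<close> and the private rate
    \<open>3 * \<epsilon>\<close>, hence the divisors. The value 1 stands where the rate is 0 and
    imposes no constraint.\<close>
  define e1 where "e1 = (if Rs < ?Hv then (?Hv - Rs) / 2 else 1)"
  define e2 where "e2 = (if Rp < ?Hu - ?Hv then (?Hu - ?Hv - Rp) / 3 else 1)"
  obtain \<epsilon> where \<epsilon>: "0 < \<epsilon>" "Rs = 0 \<or> Rs \<le> ?Hv - 2 * \<epsilon>" "Rp = 0 \<or> Rp \<le> ?Hu - ?Hv - 3 * \<epsilon>"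
  proof
    show "0 < min e1 e2" by (simp add: e1_def e2_def)
    have "Rs = 0 \<or> Rs \<le> ?Hv - 2 * e1" using Rs by (auto simp: e1_def field_simps)
    then show "Rs = 0 \<or> Rs \<le> ?Hv - 2 * min e1 e2" by linarith
    have "Rp = 0 \<or> Rp \<le> ?Hu - ?Hv - 3 * e2" using Rp by (auto simp: e2_def field_simps)
    then show "Rp = 0 \<or> Rp \<le> ?Hu - ?Hv - 3 * min e1 e2" by linarith
  qed
  \<comment> \<open>With at most \<open>(n + 1) ^ CARD('a)\<close> classes, those of probability
    below this threshold have total mass at most 1/8.\<close>
  define \<theta> :: "nat \<Rightarrow> real" where "\<theta> n = 1 / (8 * real (n + 1) ^ CARD('a))" for n
  have \<theta>_pos: "0 < \<theta> n" for n by (simp add: \<theta>_def)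
  have "(\<lambda>n. real (n + 1) ^ CARD('a) * (2 powr (- \<epsilon>)) ^ n) \<longlonglongrightarrow> 0"
    using \<epsilon>(1) by (intro poly_mult_geometric_tendsto_0) (simp_all add: powr_minus_divide)
  then have "\<forall>\<^sub>F n in sequentially. real (n + 1) ^ CARD('a) * (2 powr (- \<epsilon>)) ^ n < 1 / 8"
    by (rule order_tendstoD) simp
  then have ev1: "\<forall>\<^sub>F n in sequentially. 2 powr (- real n * \<epsilon>) \<le> \<theta> n"
  proof (rule eventually_mono)
    fix n assume "real (n + 1) ^ CARD('a) * (2 powr (- \<epsilon>)) ^ n < 1 / 8"
    moreover have "(2 powr (- \<epsilon>)) ^ n = 2 powr (- real n * \<epsilon>)"
      by (simp add: powr_realpow[symmetric] powr_powr mult.commute)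
    ultimately show "2 powr (- real n * \<epsilon>) \<le> \<theta> n" by (simp add: \<theta>_def field_simps)
  qed
  have ev2: "\<forall>\<^sub>F n in sequentially. measure_pmf.prob (iid_pmf n p) (- jointly_typical n \<epsilon> p h) < 1 / 8"
    by (rule order_tendstoD(2)[OF jointly_typical_probability[OF \<epsilon>(1)]]) simp
  show ?thesis
    using ev1 ev2
  proof eventually_elim
    fix n
    assume poly: "2 powr (- real n * \<epsilon>) \<le> \<theta> n"
      and atyp: "measure_pmf.prob (iid_pmf n p) (- jointly_typical n \<epsilon> p h) < 1 / 8"
    let ?P = "iid_pmf n p" and ?Q = "iid_pmf n (map_pmf h p)" and ?J = "jointly_typical n \<epsilon> p h"
    define cl where "cl M = {w \<in> words n. word_type n w = M}" for M :: "'a multiset"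
    define S where "S = {u \<in> ?J. \<theta> n \<le> measure_pmf.prob ?P (cl (word_type n u))}"
    have S_words: "S \<subseteq> words n" using subsetD[OF jointly_typical_subset] by (auto simp: S_def)
    have cl_J: "cl (word_type n u) \<subseteq> ?J" if "u \<in> ?J" for u
      using jointly_typical_word_type[OF that] by (auto simp: cl_def)
    \<comment> \<open>Both conditions defining \<open>S\<close> depend on the type alone, so
      \<open>S\<close> is a union of whole type classes.\<close>
    have cl_S: "{w \<in> S. word_type n w = word_type n u} = cl (word_type n u)" if "u \<in> S" for u
      using that cl_J[of u] S_words by (auto simp: S_def cl_def)
    have "measure_pmf.prob ?P (?J - S) \<le> 1 / 8"
    proof -
      let ?g = "word_type n" and ?D = "?J - S"
      have "measure_pmf.prob ?P ?D = (\<Sum>u\<in>?D. pmf ?P u)" by (intro measure_measure_pmf_finite) simp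
      also have "\<dots> = (\<Sum>M\<in>?g ` ?D. \<Sum>u\<in>{u \<in> ?D. ?g u = M}. pmf ?P u)"
        by (intro sum.group[symmetric]) auto
      also have "\<dots> \<le> (\<Sum>M\<in>?g ` ?D. \<theta> n)"
      proof (rule sum_mono)
        fix M assume "M \<in> ?g ` ?D"
        then obtain u where u: "u \<in> ?D" "M = ?g u" by blast
        have "(\<Sum>u\<in>{u \<in> ?D. ?g u = M}. pmf ?P u) = measure_pmf.prob ?P {u \<in> ?D. ?g u = M}"
          by (intro measure_measure_pmf_finite[symmetric]) simp
        also have "\<dots> \<le> measure_pmf.prob ?P (cl M)"
          using jointly_typical_subset[of n \<epsilon> p h] by (intro measure_pmf.finite_measure_mono) (auto simp: cl_def)
        also have "\<dots> \<le> \<theta> n" using u by (auto simp: S_def)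
        finally show "(\<Sum>u\<in>{u \<in> ?D. ?g u = M}. pmf ?P u) \<le> \<theta> n" .
      qed
      also have "\<dots> = real (card (?g ` ?D)) * \<theta> n" by simp
      also have "\<dots> \<le> real ((n + 1) ^ CARD('a)) * \<theta> n"
      proof (intro mult_right_mono of_nat_mono)
        have "card (?g ` ?D) \<le> card (?g ` (words n :: (nat \<Rightarrow> 'a) set))"
          using subsetD[OF jointly_typical_subset] by (intro card_mono image_mono) auto
        then show "card (?g ` ?D) \<le> (n + 1) ^ CARD('a)" using card_word_types[where 'a = 'a] order_trans by blast
      qed (simp add: \<theta>_pos less_imp_le)
      also have "\<dots> = 1 / 8" by (simp add: \<theta>_def del: of_nat_Suc)
      finally show ?thesis .
    qed
    moreover have "measure_pmf.prob ?P S = 1 - measure_pmf.prob ?P (- S)"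
      using measure_pmf.prob_compl[of S ?P] by (simp add: Compl_eq_Diff_UNIV)
    moreover have "measure_pmf.prob ?P (- S) \<le> measure_pmf.prob ?P (- ?J) + measure_pmf.prob ?P (?J - S)"
    proof -
      have "- S = - ?J \<union> (?J - S)" by (auto simp: S_def)
      then show ?thesis by (metis measure_Un_le sets_measure_pmf UNIV_I sets_UNIV)
    qed
    ultimately have prob_S: "3 / 4 \<le> measure_pmf.prob ?P S" using atyp by linarith
    moreover have "uniform_block n p h (card (messages n Rs)) (card (messages n Rp))
        {w \<in> S. word_type n w = word_type n u}" if u: "u \<in> S" for u
    proof -
      define T where "T = cl (word_type n u)"
      have T_J: "T \<subseteq> ?J" and T_prob: "\<theta> n \<le> measure_pmf.prob ?P T"
        using u cl_J by (auto simp: S_def T_def)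
      have uT: "u \<in> T" using u S_words by (auto simp: T_def cl_def)
      have finT: "finite T" by (simp add: T_def cl_def)
      have lower: "2 powr (- real n * \<epsilon>) \<le> measure_pmf.prob ?P T" using poly T_prob by simp
      \<comment> \<open>The exponent of the class size falls short of the entropy by one
        \<open>\<epsilon>\<close> for the probability of the class and one for the typicality of its
        words. The images are counted in the same way below, under the law of the side
        information.\<close>
      have "measure_pmf.prob ?P T \<le> real (card T) * 2 powr (- real n * (?Hu - \<epsilon>))"
        using T_J finT by (intro prob_le_card_mult) (auto simp: jointly_typical_def typical_def)
      with lower have "2 powr (- real n * \<epsilon>) \<le> real (card T) * 2 powr (- real n * (?Hu - \<epsilon>))" by linarith
      then have "2 powr (- real n * \<epsilon>) * 2 powr (real n * (?Hu - \<epsilon>)) \<le> real (card T)"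
        by (rule mult_powr_le_if)
      then have card_T: "2 powr (real n * (?Hu - 2 * \<epsilon>)) \<le> real (card T)"
        by (simp add: powr_add[symmetric] algebra_simps)
      have "measure_pmf.prob ?P T \<le> measure_pmf.prob ?P (map_word n h -` map_word n h ` T)"
        by (intro measure_pmf.finite_measure_mono) auto
      also have "\<dots> = measure_pmf.prob ?Q (map_word n h ` T)" by (simp add: map_pmf_iid[symmetric])
      also have "\<dots> \<le> real (card (map_word n h ` T)) * 2 powr (- real n * (?Hv - \<epsilon>))"
        using T_J finT by (intro prob_le_card_mult) (auto simp: jointly_typical_def typical_def)
      finally have "2 powr (- real n * \<epsilon>) \<le> real (card (map_word n h ` T)) * 2 powr (- real n * (?Hv - \<epsilon>))"
        using lower by linarith
      then have "2 powr (- real n * \<epsilon>) * 2 powr (real n * (?Hv - \<epsilon>)) \<le> real (card (map_word n h ` T))"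
        by (rule mult_powr_le_if)
      then have card_V: "2 powr (real n * (?Hv - 2 * \<epsilon>)) \<le> real (card (map_word n h ` T))"
        by (simp add: powr_add[symmetric] algebra_simps)
      have ms: "card (messages n Rs) \<le> card (map_word n h ` T)"
      proof (cases "Rs = 0")
        case True
        then show ?thesis using uT finT by (auto simp: card_messages Suc_le_eq card_gt_0_iff)
      next
        case False
        have "real (card (messages n Rs)) \<le> 2 powr (real n * Rs)" by (rule card_messages_le)
        also have "\<dots> \<le> 2 powr (real n * (?Hv - 2 * \<epsilon>))"
          using \<epsilon> False by (intro powr_mono mult_left_mono) auto
        finally show ?thesis using card_V by linarith
      qed
      have mp: "card (messages n Rp) * card (map_word n h ` T) \<le> card T"
      proof (cases "Rp = 0")
        case True
        then show ?thesis using card_image_le[OF finT] by (simp add: card_messages)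
      next
        case False
        \<comment> \<open>The images contribute at most \<open>?Hv + \<epsilon>\<close> to the
          exponent and the class has at least \<open>?Hu - 2 * \<epsilon>\<close>; the difference is
          the source of \<open>3 * \<epsilon>\<close>.\<close>
        have "real (card (messages n Rp)) * real (card (map_word n h ` T)) \<le>
            2 powr (real n * Rp) * 2 powr (real n * (?Hv + \<epsilon>))"
          using T_J by (intro mult_mono card_messages_le card_image_jointly_typical_le) auto
        also have "\<dots> \<le> 2 powr (real n * (?Hu - ?Hv - 3 * \<epsilon>)) * 2 powr (real n * (?Hv + \<epsilon>))"
          using \<epsilon> False by (intro mult_right_mono powr_mono mult_left_mono) auto
        also have "\<dots> = 2 powr (real n * (?Hu - 2 * \<epsilon>))"
          by (simp add: powr_add[symmetric] algebra_simps)
        finally show ?thesis using card_T by (simp flip: of_nat_mult)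
      qed
      have "0 < 2 powr (- real n * (?Hu + \<epsilon>))" by simp
      also have "\<dots> \<le> pmf ?P u" using T_J uT by (auto simp: jointly_typical_def typical_def)
      finally have "uniform_block n p h (card (messages n Rs)) (card (messages n Rp)) T"
        using uT ms mp by (intro uniform_block_type_class[where M = "word_type n u"]) (simp_all add: T_def cl_def)
      then show ?thesis using cl_S[OF u] by (simp add: T_def)
    qed
    ultimately show "\<exists>S \<subseteq> words n. 3 / 4 \<le> measure_pmf.prob ?P S \<and>
      (\<forall>u\<in>S. uniform_block n p h (card (messages n Rs)) (card (messages n Rp))
        {w \<in> S. word_type n w = word_type n u})" using S_words by blast
  qed
qed

text \<open>If the conditional error exceeded twice the overall error \<open>E\<close> on every pair
  of blocks, then summing over the pairs would give an error above \<open>2 * E\<close> times the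
  mass of the product of \<open>S1\<close> and \<open>S2\<close>, hence above
  \<open>E\<close>.\<close>

lemma exists_good_block_pair:
  fixes g1 :: "'a \<Rightarrow> 'm1" and g2 :: "'b \<Rightarrow> 'm2" and F :: "'a \<Rightarrow> 'b \<Rightarrow> real"
  assumes fin: "finite S1" "finite S2" "finite A1" "finite A2" and sub: "S1 \<subseteq> A1" "S2 \<subseteq> A2"
    and nonneg: "\<And>a. 0 \<le> q1 a" "\<And>b. 0 \<le> q2 b" "\<And>a b. 0 \<le> F a b"
    and mass: "3 / 4 \<le> sum q1 S1" "3 / 4 \<le> sum q2 S2"
  shows "\<exists>a\<in>S1. \<exists>b\<in>S2.
    (\<Sum>x\<in>{x \<in> S1. g1 x = g1 a}. \<Sum>y\<in>{y \<in> S2. g2 y = g2 b}. q1 x * q2 y * F x y) \<le>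
    2 * (\<Sum>x\<in>A1. \<Sum>y\<in>A2. q1 x * q2 y * F x y) *
      (sum q1 {x \<in> S1. g1 x = g1 a} * sum q2 {y \<in> S2. g2 y = g2 b})"
proof (rule ccontr)
  let ?T1 = "\<lambda>M. {x \<in> S1. g1 x = M}" and ?T2 = "\<lambda>M. {y \<in> S2. g2 y = M}"
  let ?I = "g1 ` S1 \<times> g2 ` S2"
  define E where "E = (\<Sum>x\<in>A1. \<Sum>y\<in>A2. q1 x * q2 y * F x y)"
  assume neg: "\<not> ?thesis"
  have E: "0 \<le> E" unfolding E_def by (intro sum_nonneg mult_nonneg_nonneg nonneg)
  have regroup: "(\<Sum>x\<in>S1. \<Sum>y\<in>S2. f x y) =
      (\<Sum>(M1, M2)\<in>?I. \<Sum>x\<in>?T1 M1. \<Sum>y\<in>?T2 M2. f x y)" for f :: "'a \<Rightarrow> 'b \<Rightarrow> real"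
  proof -
    have "(\<Sum>x\<in>S1. \<Sum>y\<in>S2. f x y) = (\<Sum>M1\<in>g1 ` S1. \<Sum>x\<in>?T1 M1. \<Sum>y\<in>S2. f x y)"
      using fin by (intro sum.group[symmetric]) auto
    also have "\<dots> = (\<Sum>M1\<in>g1 ` S1. \<Sum>x\<in>?T1 M1. \<Sum>M2\<in>g2 ` S2. \<Sum>y\<in>?T2 M2. f x y)"
      using fin by (intro sum.cong refl sum.group[symmetric]) auto
    also have "\<dots> = (\<Sum>M1\<in>g1 ` S1. \<Sum>M2\<in>g2 ` S2. \<Sum>x\<in>?T1 M1. \<Sum>y\<in>?T2 M2. f x y)"
      by (intro sum.cong refl sum.swap)
    finally show ?thesis by (simp add: sum.cartesian_product)
  qed
  have "S1 \<noteq> {}" "S2 \<noteq> {}" using mass by auto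
  have "2 * E * (sum q1 S1 * sum q2 S2) = (\<Sum>x\<in>S1. \<Sum>y\<in>S2. 2 * E * (q1 x * q2 y))"
    by (subst sum_product) (simp only: sum_distrib_left)
  also have "\<dots> = (\<Sum>(M1, M2)\<in>?I. \<Sum>x\<in>?T1 M1. \<Sum>y\<in>?T2 M2. 2 * E * (q1 x * q2 y))"
    by (rule regroup)
  also have "\<dots> = (\<Sum>(M1, M2)\<in>?I. 2 * E * (sum q1 (?T1 M1) * sum q2 (?T2 M2)))"
    by (simp only: sum_product) (simp only: sum_distrib_left)
  also have "\<dots> < (\<Sum>(M1, M2)\<in>?I. \<Sum>x\<in>?T1 M1. \<Sum>y\<in>?T2 M2. q1 x * q2 y * F x y)"
    using neg fin \<open>S1 \<noteq> {}\<close> \<open>S2 \<noteq> {}\<close> by (intro sum_strict_mono) (auto simp: E_def not_le)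
  also have "\<dots> = (\<Sum>x\<in>S1. \<Sum>y\<in>S2. q1 x * q2 y * F x y)" by (rule regroup[symmetric])
  also have "\<dots> \<le> (\<Sum>x\<in>S1. \<Sum>y\<in>A2. q1 x * q2 y * F x y)"
    using fin sub by (intro sum_mono sum_mono2) (auto simp: nonneg)
  also have "\<dots> \<le> E"
    unfolding E_def using fin sub by (intro sum_mono2) (auto simp: nonneg sum_nonneg)
  finally have "2 * E * (sum q1 S1 * sum q2 S2) < E" .
  \<comment> \<open>The mass 3/4 on each side suffices because
    \<open>2 * (3 / 4 * (3 / 4)) = 9 / 8\<close> is at least 1.\<close>
  moreover have "1 * E \<le> (2 * (3 / 4 * (3 / 4))) * E" using E by (intro mult_right_mono) auto
  moreover have "2 * (3 / 4 * (3 / 4)) * E \<le> 2 * (sum q1 S1 * sum q2 S2) * E"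
    using mass E by (intro mult_right_mono mult_left_mono mult_mono) auto
  ultimately show False by (simp add: mult_ac)
qed

section \<open>Conversion of codes\<close>

text \<open>A message pair is sent as the source word that \<open>L\<close> assigns to its
  relabelled indices. The source is uniform on each block, so its error there is a plain average
  over all indices, and the best shifts bring the message average below it. The bound is multiplied
  by the block probabilities to match the weighted sum of the source error.\<close>

lemma channel_code_from_source_code:
  fixes W :: "('x1, 'x2, 'y1, 'y2) ichannel"
    and p1 :: "'u1::finite pmf" and p2 :: "'u2::finite pmf"
    and h1 :: "'u1 \<Rightarrow> 'v1::finite" and h2 :: "'u2 \<Rightarrow> 'v2::finite"
  assumes code: "source_code n f1 f2 g1 g2"
    and nonneg: "0 \<le> R1s" "0 \<le> R1p" "0 \<le> R2s" "0 \<le> R2p"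
    and T1: "uniform_block n p1 h1 (card (messages n R1s)) (card (messages n R1p)) T1"
    and T2: "uniform_block n p2 h2 (card (messages n R2s)) (card (messages n R2p)) T2"
  shows "\<exists>e1 e2 d1 d2. channel_code n (R1s, R1p, R2s, R2p) e1 e2 d1 d2 \<and>
    channel_error W n (R1s, R1p, R2s, R2p) e1 e2 d1 d2 *
      (sum (pmf (iid_pmf n p1)) T1 * sum (pmf (iid_pmf n p2)) T2) \<le>
    (\<Sum>x\<in>T1. \<Sum>y\<in>T2. pmf (iid_pmf n p1) x * pmf (iid_pmf n p2) y *
      source_fail W h1 h2 n f1 f2 g1 g2 x y)"
proof -
  obtain c1 k1 L1 where c1: "0 < c1" "\<And>u. u \<in> T1 \<Longrightarrow> pmf (iid_pmf n p1) u = c1"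
    and L1: "bij_betw L1 (map_word n h1 ` T1 \<times> {..<k1}) T1"
      "\<And>v j. v \<in> map_word n h1 ` T1 \<Longrightarrow> j < k1 \<Longrightarrow> map_word n h1 (L1 (v, j)) = v"
    and k1: "card (messages n R1s) \<le> card (map_word n h1 ` T1)" "card (messages n R1p) \<le> k1"
    and T1w: "T1 \<subseteq> words n"
    using T1 unfolding uniform_block_def by blast
  obtain c2 k2 L2 where c2: "0 < c2" "\<And>u. u \<in> T2 \<Longrightarrow> pmf (iid_pmf n p2) u = c2"
    and L2: "bij_betw L2 (map_word n h2 ` T2 \<times> {..<k2}) T2"
      "\<And>v j. v \<in> map_word n h2 ` T2 \<Longrightarrow> j < k2 \<Longrightarrow> map_word n h2 (L2 (v, j)) = v"
    and k2: "card (messages n R2s) \<le> card (map_word n h2 ` T2)" "card (messages n R2p) \<le> k2"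
    and T2w: "T2 \<subseteq> words n"
    using T2 unfolding uniform_block_def by blast
  let ?V1 = "map_word n h1 ` T1" and ?V2 = "map_word n h2 ` T2"
  let ?M1s = "messages n R1s" and ?M1p = "messages n R1p"
  let ?M2s = "messages n R2s" and ?M2p = "messages n R2p"
  let ?sf = "source_fail W h1 h2 n f1 f2 g1 g2"
  have fin: "finite T1" "finite T2" using finite_subset[OF T1w] finite_subset[OF T2w] by auto
  have ne: "T1 \<noteq> {}" "T2 \<noteq> {}" using T1 T2 by (auto simp: uniform_block_def)
  have pos: "0 < card ?M1s" "0 < card ?M1p" "0 < card ?M2s" "0 < card ?M2p"
    using nonneg by (simp_all add: card_gt_0_iff messages_nonempty)
  have k_pos: "0 < k1" "0 < k2" using pos k1 k2 by linarith+
  define G where "G v1 j1 v2 j2 = ?sf (L1 (v1, j1)) (L2 (v2, j2))" for v1 j1 v2 j2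
  let ?\<Omega> = "?M1s \<times> ?M1p \<times> ?M2s \<times> ?M2p"
  have B: "finite ?V1" "finite {..<k1}" "finite ?V2" "finite {..<k2}"
      "?V1 \<noteq> {}" "{..<k1} \<noteq> {}" "?V2 \<noteq> {}" "{..<k2} \<noteq> {}"
    using fin ne k_pos by auto
  have card: "card ?M1s \<le> card ?V1" "card ?M1p \<le> card {..<k1}"
      "card ?M2s \<le> card ?V2" "card ?M2p \<le> card {..<k2}"
    using k1 k2 by simp_all
  have m: "fst \<in> ?\<Omega> \<rightarrow> ?M1s" "(\<lambda>w. fst (snd w)) \<in> ?\<Omega> \<rightarrow> ?M1p"
      "(\<lambda>w. fst (snd (snd w))) \<in> ?\<Omega> \<rightarrow> ?M2s" "(\<lambda>w. snd (snd (snd w))) \<in> ?\<Omega> \<rightarrow> ?M2p"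
    by auto
  obtain \<sigma>1 \<sigma>2 \<sigma>3 \<sigma>4 where
    s: "\<sigma>1 \<in> ?M1s \<rightarrow> ?V1" "\<sigma>2 \<in> ?M1p \<rightarrow> {..<k1}" "\<sigma>3 \<in> ?M2s \<rightarrow> ?V2" "\<sigma>4 \<in> ?M2p \<rightarrow> {..<k2}"
    and inj: "inj_on \<sigma>1 ?M1s" "inj_on \<sigma>2 ?M1p" "inj_on \<sigma>3 ?M2s" "inj_on \<sigma>4 ?M2p"
    and avg: "(\<Sum>w\<in>?\<Omega>. 1 * G (\<sigma>1 (fst w)) (\<sigma>2 (fst (snd w))) (\<sigma>3 (fst (snd (snd w)))) (\<sigma>4 (snd (snd (snd w))))) \<le>
      (\<Sum>w\<in>?\<Omega>. 1) * ((\<Sum>b1\<in>?V1. \<Sum>b2\<in>{..<k1}. \<Sum>b3\<in>?V2. \<Sum>b4\<in>{..<k2}. G b1 b2 b3 b4) /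
      (real (card ?V1) * real (card {..<k1}) * real (card ?V2) * real (card {..<k2})))"
    using exists_four_injections_avg_le[OF finite_messages finite_messages finite_messages finite_messages
        B(1-8) card m, where q = "\<lambda>_. 1" and G = G] by blast
  have card_T: "card T1 = card ?V1 * k1" "card T2 = card ?V2 * k2"
    using bij_betw_same_card[OF L1(1)] bij_betw_same_card[OF L2(1)] by (simp_all add: card_cartesian_product)
  have total: "(\<Sum>b1\<in>?V1. \<Sum>b2\<in>{..<k1}. \<Sum>b3\<in>?V2. \<Sum>b4\<in>{..<k2}. G b1 b2 b3 b4) =
      (\<Sum>x\<in>T1. \<Sum>y\<in>T2. ?sf x y)"
  proof -
    have "(\<Sum>x\<in>T1. \<Sum>y\<in>T2. ?sf x y) = (\<Sum>w\<in>?V1 \<times> {..<k1}. \<Sum>y\<in>T2. ?sf (L1 w) y)"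
      by (rule sum.reindex_bij_betw[OF L1(1), symmetric])
    also have "\<dots> = (\<Sum>w\<in>?V1 \<times> {..<k1}. \<Sum>w'\<in>?V2 \<times> {..<k2}. ?sf (L1 w) (L2 w'))"
      by (intro sum.cong refl sum.reindex_bij_betw[OF L2(1), symmetric])
    finally show ?thesis by (simp only: G_def sum.cartesian_product')
  qed
  define E1 where "E1 w = L1 (\<sigma>1 (fst w), \<sigma>2 (snd w))" for w
  define E2 where "E2 w = L2 (\<sigma>3 (fst w), \<sigma>4 (snd w))" for w
  have E1: "inj_on E1 (?M1s \<times> ?M1p)" "E1 ` (?M1s \<times> ?M1p) \<subseteq> T1"
  proof -
    have "inj_on (L1 \<circ> map_prod \<sigma>1 \<sigma>2) (?M1s \<times> ?M1p)"
      using s inj by (intro comp_inj_on map_prod_inj_on inj_on_subset[OF bij_betw_imp_inj_on[OF L1(1)]]) auto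
    then show "inj_on E1 (?M1s \<times> ?M1p)" by (simp add: E1_def[abs_def] o_def map_prod_def case_prod_beta')
    show "E1 ` (?M1s \<times> ?M1p) \<subseteq> T1"
    proof (intro image_subsetI)
      fix w assume "w \<in> ?M1s \<times> ?M1p"
      then have "(\<sigma>1 (fst w), \<sigma>2 (snd w)) \<in> ?V1 \<times> {..<k1}"
        using funcset_mem[OF s(1), of "fst w"] funcset_mem[OF s(2), of "snd w"] by (simp add: mem_Times_iff)
      then show "E1 w \<in> T1" unfolding E1_def by (rule bspec[OF bij_betwE[OF L1(1)]])
    qed
  qed
  have E2: "inj_on E2 (?M2s \<times> ?M2p)" "E2 ` (?M2s \<times> ?M2p) \<subseteq> T2"
  proof -
    have "inj_on (L2 \<circ> map_prod \<sigma>3 \<sigma>4) (?M2s \<times> ?M2p)"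
      using s inj by (intro comp_inj_on map_prod_inj_on inj_on_subset[OF bij_betw_imp_inj_on[OF L2(1)]]) auto
    then show "inj_on E2 (?M2s \<times> ?M2p)" by (simp add: E2_def[abs_def] o_def map_prod_def case_prod_beta')
    show "E2 ` (?M2s \<times> ?M2p) \<subseteq> T2"
    proof (intro image_subsetI)
      fix w assume "w \<in> ?M2s \<times> ?M2p"
      then have "(\<sigma>3 (fst w), \<sigma>4 (snd w)) \<in> ?V2 \<times> {..<k2}"
        using funcset_mem[OF s(3), of "fst w"] funcset_mem[OF s(4), of "snd w"] by (simp add: mem_Times_iff)
      then show "E2 w \<in> T2" unfolding E2_def by (rule bspec[OF bij_betwE[OF L2(1)]])
    qed
  qed
  \<comment> \<open>The shared message alone fixes the side information word, so the opposite
    receiver can supply it to the source decoder.\<close>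
  have side1: "map_word n h1 (E1 (a, b)) = \<sigma>1 a" if "a \<in> ?M1s" "b \<in> ?M1p" for a b
    using that s L1(2)[of "\<sigma>1 a" "\<sigma>2 b"] unfolding E1_def by (simp add: Pi_iff)
  have side2: "map_word n h2 (E2 (a, b)) = \<sigma>3 a" if "a \<in> ?M2s" "b \<in> ?M2p" for a b
    using that s L2(2)[of "\<sigma>3 a" "\<sigma>4 b"] unfolding E2_def by (simp add: Pi_iff)
  obtain z1 z2 where z: "z1 \<in> ?M1s \<times> ?M1p" "z2 \<in> ?M2s \<times> ?M2p"
    using nonneg messages_nonempty by (metis equals0I mem_Sigma_iff)
  \<comment> \<open>A decoded word that encodes no message is sent to the fixed pair
    \<open>z1\<close>, which keeps the decoder inside the message sets.\<close>
  define D1 where "D1 u = (if u \<in> E1 ` (?M1s \<times> ?M1p) then inv_into (?M1s \<times> ?M1p) E1 u else z1)" for u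
  define D2 where "D2 u = (if u \<in> E2 ` (?M2s \<times> ?M2p) then inv_into (?M2s \<times> ?M2p) E2 u else z2)" for u
  have D_in: "D1 u \<in> ?M1s \<times> ?M1p" "D2 u' \<in> ?M2s \<times> ?M2p" for u u'
    unfolding D1_def D2_def using z by (auto simp del: mem_Sigma_iff intro: inv_into_into)
  have D1E1: "D1 (E1 w) = w" if "w \<in> ?M1s \<times> ?M1p" for w
    using that inv_into_f_f[OF E1(1)] by (auto simp: D1_def)
  have D2E2: "D2 (E2 w) = w" if "w \<in> ?M2s \<times> ?M2p" for w
    using that inv_into_f_f[OF E2(1)] by (auto simp: D2_def)
  let ?e1 = "\<lambda>w. f1 (E1 w)" and ?e2 = "\<lambda>w. f2 (E2 w)"
  let ?d1 = "\<lambda>(y, w2s). D1 (g1 (y, \<sigma>3 w2s))" and ?d2 = "\<lambda>(y, w1s). D2 (g2 (y, \<sigma>1 w1s))"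
  have is_code: "channel_code n (R1s, R1p, R2s, R2p) ?e1 ?e2 ?d1 ?d2"
    unfolding channel_code_def prod.case
  proof (intro conjI)
    show "?e1 \<in> ?M1s \<times> ?M1p \<rightarrow> words n" "?e2 \<in> ?M2s \<times> ?M2p \<rightarrow> words n"
      using code E1(2) E2(2) T1w T2w by (fastforce simp: source_code_def)+
    show "?d1 \<in> words n \<times> ?M2s \<rightarrow> ?M1s \<times> ?M1p" "?d2 \<in> words n \<times> ?M1s \<rightarrow> ?M2s \<times> ?M2p"
      using D_in by (auto simp del: mem_Sigma_iff)
  qed
  \<comment> \<open>\<open>D1\<close> and \<open>D2\<close> invert the embeddings, so a wrong
    message estimate forces a wrong source word estimate under the same channel output.\<close>
  have fail_le: "channel_fail W n ?e1 ?e2 ?d1 ?d2 a b c d \<le> G (\<sigma>1 a) (\<sigma>2 b) (\<sigma>3 c) (\<sigma>4 d)"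
    if m: "a \<in> ?M1s" "b \<in> ?M1p" "c \<in> ?M2s" "d \<in> ?M2p" for a b c d
  proof -
    have G: "G (\<sigma>1 a) (\<sigma>2 b) (\<sigma>3 c) (\<sigma>4 d) = ?sf (E1 (a, b)) (E2 (c, d))"
      by (simp add: G_def E1_def E2_def)
    show ?thesis
      unfolding G source_fail_def channel_fail_def
      using m D1E1[of "(a, b)"] D2E2[of "(c, d)"]
      by (intro measure_pmf.finite_measure_mono) (auto simp: side1 side2)
  qed
  let ?cf = "channel_fail W n ?e1 ?e2 ?d1 ?d2"
  have "(\<Sum>a\<in>?M1s. \<Sum>b\<in>?M1p. \<Sum>c\<in>?M2s. \<Sum>d\<in>?M2p. ?cf a b c d) \<le>
      (\<Sum>a\<in>?M1s. \<Sum>b\<in>?M1p. \<Sum>c\<in>?M2s. \<Sum>d\<in>?M2p. G (\<sigma>1 a) (\<sigma>2 b) (\<sigma>3 c) (\<sigma>4 d))"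
    by (intro sum_mono fail_le)
  also have "\<dots> = (\<Sum>w\<in>?\<Omega>. 1 * G (\<sigma>1 (fst w)) (\<sigma>2 (fst (snd w))) (\<sigma>3 (fst (snd (snd w)))) (\<sigma>4 (snd (snd (snd w)))))"
    by (simp add: sum.cartesian_product case_prod_beta')
  also note avg
  also have "(\<Sum>w\<in>?\<Omega>. 1) * ((\<Sum>b1\<in>?V1. \<Sum>b2\<in>{..<k1}. \<Sum>b3\<in>?V2. \<Sum>b4\<in>{..<k2}. G b1 b2 b3 b4) /
      (real (card ?V1) * real (card {..<k1}) * real (card ?V2) * real (card {..<k2}))) =
      (real (card ?M1s) * real (card ?M1p) * real (card ?M2s) * real (card ?M2p)) *
      ((\<Sum>x\<in>T1. \<Sum>y\<in>T2. ?sf x y) / (real (card T1) * real (card T2)))"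
    unfolding total by (simp add: card_T card_cartesian_product mult_ac)
  finally have err: "channel_error W n (R1s, R1p, R2s, R2p) ?e1 ?e2 ?d1 ?d2 \<le>
      (\<Sum>x\<in>T1. \<Sum>y\<in>T2. ?sf x y) / (real (card T1) * real (card T2))"
    unfolding channel_error_eq[OF nonneg] using pos
    by (subst pos_divide_le_eq) (simp_all add: mult_ac)
  have cT: "0 < card T1" "0 < card T2" using fin ne by (auto simp: card_gt_0_iff)
  \<comment> \<open>The constant probabilities \<open>c1\<close> and \<open>c2\<close> on the blocks
    turn the unweighted average back into a sum weighted by the source law.\<close>
  have "channel_error W n (R1s, R1p, R2s, R2p) ?e1 ?e2 ?d1 ?d2 *
      (sum (pmf (iid_pmf n p1)) T1 * sum (pmf (iid_pmf n p2)) T2) =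
      channel_error W n (R1s, R1p, R2s, R2p) ?e1 ?e2 ?d1 ?d2 * ((real (card T1) * c1) * (real (card T2) * c2))"
    by (simp add: c1(2) c2(2))
  also have "\<dots> \<le> (\<Sum>x\<in>T1. \<Sum>y\<in>T2. ?sf x y) / (real (card T1) * real (card T2)) *
      ((real (card T1) * c1) * (real (card T2) * c2))"
    using c1(1) c2(1) by (intro mult_right_mono err) simp
  also have "\<dots> = (\<Sum>x\<in>T1. \<Sum>y\<in>T2. c1 * c2 * ?sf x y)"
    using cT by (simp add: sum_distrib_left[symmetric])
  also have "\<dots> = (\<Sum>x\<in>T1. \<Sum>y\<in>T2. pmf (iid_pmf n p1) x * pmf (iid_pmf n p2) y * ?sf x y)"
    by (intro sum.cong refl) (simp add: c1(2) c2(2))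
  finally show ?thesis using is_code by blast
qed

text \<open>A source word is sent as its two indices after relabelling. The indices are not uniform,
  but some choice of shifts of the message sets has error at most the uniform average of the channel
  code. Each receiver computes the shared message of the other user from the side information word.
  Words outside \<open>J1\<close> or \<open>J2\<close> are counted as errors.\<close>

lemma source_code_from_channel_code:
  fixes W :: "('x1, 'x2, 'y1, 'y2) ichannel"
    and p1 :: "'u1::finite pmf" and p2 :: "'u2::finite pmf"
    and h1 :: "'u1 \<Rightarrow> 'v1::finite" and h2 :: "'u2 \<Rightarrow> 'v2::finite"
  assumes code: "channel_code n (R1s, R1p, R2s, R2p) e1 e2 d1 d2"
    and nonneg: "0 \<le> R1s" "0 \<le> R1p" "0 \<le> R2s" "0 \<le> R2p"
    and st1: "s1 \<in> UNIV \<rightarrow> messages n R1s" "t1 \<in> UNIV \<rightarrow> messages n R1p"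
      "inj_on (\<lambda>u. (s1 (map_word n h1 u), t1 u)) J1" and J1: "J1 \<subseteq> words n"
    and st2: "s2 \<in> UNIV \<rightarrow> messages n R2s" "t2 \<in> UNIV \<rightarrow> messages n R2p"
      "inj_on (\<lambda>u. (s2 (map_word n h2 u), t2 u)) J2" and J2: "J2 \<subseteq> words n"
  shows "\<exists>f1 f2 g1 g2. source_code n f1 f2 g1 g2 \<and>
    source_error W p1 p2 h1 h2 n f1 f2 g1 g2 \<le>
      measure_pmf.prob (iid_pmf n p1) (- J1) + measure_pmf.prob (iid_pmf n p2) (- J2) +
      channel_error W n (R1s, R1p, R2s, R2p) e1 e2 d1 d2"
proof -
  let ?M1s = "messages n R1s" and ?M1p = "messages n R1p"
  let ?M2s = "messages n R2s" and ?M2p = "messages n R2p"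
  let ?cf = "channel_fail W n e1 e2 d1 d2"
  let ?P1 = "iid_pmf n p1" and ?P2 = "iid_pmf n p2"
  let ?\<Omega> = "(words n :: (nat \<Rightarrow> 'u1) set) \<times> (words n :: (nat \<Rightarrow> 'u2) set)"
  let ?q = "\<lambda>w. pmf ?P1 (fst w) * pmf ?P2 (snd w)"
  have m: "(\<lambda>w. s1 (map_word n h1 (fst w))) \<in> ?\<Omega> \<rightarrow> ?M1s" "(\<lambda>w. t1 (fst w)) \<in> ?\<Omega> \<rightarrow> ?M1p"
    "(\<lambda>w. s2 (map_word n h2 (snd w))) \<in> ?\<Omega> \<rightarrow> ?M2s" "(\<lambda>w. t2 (snd w)) \<in> ?\<Omega> \<rightarrow> ?M2p"
    using st1 st2 by auto
  obtain \<sigma>1 \<sigma>2 \<sigma>3 \<sigma>4 where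
    s: "\<sigma>1 \<in> ?M1s \<rightarrow> ?M1s" "\<sigma>2 \<in> ?M1p \<rightarrow> ?M1p" "\<sigma>3 \<in> ?M2s \<rightarrow> ?M2s" "\<sigma>4 \<in> ?M2p \<rightarrow> ?M2p"
    and inj: "inj_on \<sigma>1 ?M1s" "inj_on \<sigma>2 ?M1p" "inj_on \<sigma>3 ?M2s" "inj_on \<sigma>4 ?M2p"
    and avg: "(\<Sum>w\<in>?\<Omega>. ?q w * ?cf (\<sigma>1 (s1 (map_word n h1 (fst w)))) (\<sigma>2 (t1 (fst w)))
        (\<sigma>3 (s2 (map_word n h2 (snd w)))) (\<sigma>4 (t2 (snd w)))) \<le>
      (\<Sum>w\<in>?\<Omega>. ?q w) * ((\<Sum>b1\<in>?M1s. \<Sum>b2\<in>?M1p. \<Sum>b3\<in>?M2s. \<Sum>b4\<in>?M2p. ?cf b1 b2 b3 b4) /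
      (real (card ?M1s) * real (card ?M1p) * real (card ?M2s) * real (card ?M2p)))"
    using exists_four_injections_avg_le[OF finite_messages finite_messages finite_messages finite_messages
        finite_messages finite_messages finite_messages finite_messages
        messages_nonempty[OF nonneg(1)] messages_nonempty[OF nonneg(2)]
        messages_nonempty[OF nonneg(3)] messages_nonempty[OF nonneg(4)]
        order_refl order_refl order_refl order_refl m, where q = ?q and G = ?cf] by blast
  have "(\<Sum>w\<in>?\<Omega>. ?q w) = (\<Sum>u\<in>words n. pmf ?P1 u) * (\<Sum>u\<in>words n. pmf ?P2 u)"
    by (simp add: sum_product sum.cartesian_product case_prod_beta')
  then have q1: "(\<Sum>w\<in>?\<Omega>. ?q w) = 1" by (simp add: sum_pmf_iid)
  define E1 where "E1 u = (\<sigma>1 (s1 (map_word n h1 u)), \<sigma>2 (t1 u))" for u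
  define E2 where "E2 u = (\<sigma>3 (s2 (map_word n h2 u)), \<sigma>4 (t2 u))" for u
  have E1: "inj_on E1 J1" "E1 u \<in> ?M1s \<times> ?M1p" for u
  proof -
    have "inj_on (map_prod \<sigma>1 \<sigma>2 \<circ> (\<lambda>u. (s1 (map_word n h1 u), t1 u))) J1"
      using st1 inj by (intro comp_inj_on inj_on_subset[OF map_prod_inj_on]) auto
    then show "inj_on E1 J1" by (simp add: E1_def[abs_def] o_def)
    show "E1 u \<in> ?M1s \<times> ?M1p" using s st1 by (auto simp: E1_def)
  qed
  have E2: "inj_on E2 J2" "E2 u \<in> ?M2s \<times> ?M2p" for u
  proof -
    have "inj_on (map_prod \<sigma>3 \<sigma>4 \<circ> (\<lambda>u. (s2 (map_word n h2 u), t2 u))) J2"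
      using st2 inj by (intro comp_inj_on inj_on_subset[OF map_prod_inj_on]) auto
    then show "inj_on E2 J2" by (simp add: E2_def[abs_def] o_def)
    show "E2 u \<in> ?M2s \<times> ?M2p" using s st2 by (auto simp: E2_def)
  qed
  obtain z1 :: "nat \<Rightarrow> 'u1" and z2 :: "nat \<Rightarrow> 'u2" where z: "z1 \<in> words n" "z2 \<in> words n"
    using words_nonempty by (metis equals0I)
  define D1 where "D1 w = (if w \<in> E1 ` J1 then inv_into J1 E1 w else z1)" for w
  define D2 where "D2 w = (if w \<in> E2 ` J2 then inv_into J2 E2 w else z2)" for w
  have D_in: "D1 w \<in> words n" "D2 w' \<in> words n" for w w'
    unfolding D1_def D2_def using z inv_into_into[of w E1 J1] inv_into_into[of w' E2 J2] J1 J2 by auto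
  have D1E1: "D1 (E1 u) = u" if "u \<in> J1" for u
    using that inv_into_f_f[OF E1(1)] by (auto simp: D1_def)
  have D2E2: "D2 (E2 u) = u" if "u \<in> J2" for u
    using that inv_into_f_f[OF E2(1)] by (auto simp: D2_def)
  let ?f1 = "\<lambda>u. e1 (E1 u)" and ?f2 = "\<lambda>u. e2 (E2 u)"
  let ?g1 = "\<lambda>(y, v). D1 (d1 (y, \<sigma>3 (s2 v)))" and ?g2 = "\<lambda>(y, v). D2 (d2 (y, \<sigma>1 (s1 v)))"
  have is_code: "source_code n ?f1 ?f2 ?g1 ?g2"
    unfolding source_code_def
  proof (intro conjI)
    have e: "e1 \<in> ?M1s \<times> ?M1p \<rightarrow> words n" "e2 \<in> ?M2s \<times> ?M2p \<rightarrow> words n"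
      using code by (simp_all add: channel_code_def)
    show "?f1 \<in> words n \<rightarrow> words n" "?f2 \<in> words n \<rightarrow> words n"
      using funcset_mem[OF e(1) E1(2)] funcset_mem[OF e(2) E2(2)] by auto
    show "?g1 \<in> words n \<times> words n \<rightarrow> words n" "?g2 \<in> words n \<times> words n \<rightarrow> words n"
      by (intro funcsetI; simp only: case_prod_beta' D_in)+
  qed
  let ?cfu = "\<lambda>u1 u2. ?cf (\<sigma>1 (s1 (map_word n h1 u1))) (\<sigma>2 (t1 u1)) (\<sigma>3 (s2 (map_word n h2 u2))) (\<sigma>4 (t2 u2))"
  have fail_le: "source_fail W h1 h2 n ?f1 ?f2 ?g1 ?g2 u1 u2 \<le>
      indicator (- J1) u1 + indicator (- J2) u2 + ?cfu u1 u2" for u1 u2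
  proof (cases "u1 \<in> J1 \<and> u2 \<in> J2")
    case True
    then have "D1 (E1 u1) = u1" "D2 (E2 u2) = u2" using D1E1 D2E2 by auto
    then have "source_fail W h1 h2 n ?f1 ?f2 ?g1 ?g2 u1 u2 \<le> ?cfu u1 u2"
      unfolding source_fail_def channel_fail_def E1_def[symmetric] E2_def[symmetric]
      by (intro measure_pmf.finite_measure_mono) (auto simp: E1_def E2_def)
    then show ?thesis using True by simp
  next
    case False
    then have "1 \<le> (indicator (- J1) u1 + indicator (- J2) u2 :: real)"
      by (auto simp: indicator_def)
    then show ?thesis
      using source_fail_bounds(2)[of W h1 h2 n ?f1 ?f2 ?g1 ?g2 u1 u2]
        channel_fail_nonneg[of W n e1 e2 d1 d2 "\<sigma>1 (s1 (map_word n h1 u1))" "\<sigma>2 (t1 u1)"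
          "\<sigma>3 (s2 (map_word n h2 u2))" "\<sigma>4 (t2 u2)"] by linarith
  qed
  have out: "(\<Sum>u\<in>words n. pmf (iid_pmf n p) u * indicator (- J) u) = measure_pmf.prob (iid_pmf n p) (- J)"
    for p :: "'a::finite pmf" and J
  proof -
    have "measure_pmf.prob (iid_pmf n p) (- J) = measure_pmf.expectation (iid_pmf n p) (indicator (- J))"
      by simp
    also have "\<dots> = (\<Sum>u\<in>words n. pmf (iid_pmf n p) u * indicator (- J) u)"
      using set_iid_pmf by (subst integral_measure_pmf[of "words n"]) auto
    finally show ?thesis ..
  qed
  \<comment> \<open>Multiplying out leaves each atypicality term times the total mass of the other
    source, which is 1, plus the channel term.\<close>
  have expand: "(\<Sum>x\<in>A. \<Sum>y\<in>B. p x * q y * (i x + j y + F x y)) =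
      (\<Sum>x\<in>A. p x * i x) * (\<Sum>y\<in>B. q y) + (\<Sum>x\<in>A. p x) * (\<Sum>y\<in>B. q y * j y) +
      (\<Sum>x\<in>A. \<Sum>y\<in>B. p x * q y * F x y)"
    for A :: "'a set" and B :: "'b set" and p q i j and F :: "'a \<Rightarrow> 'b \<Rightarrow> real"
    by (simp only: sum_product sum.distrib[symmetric]) (simp only: algebra_simps)
  have "source_error W p1 p2 h1 h2 n ?f1 ?f2 ?g1 ?g2 \<le>
      (\<Sum>u1\<in>words n. \<Sum>u2\<in>words n. pmf ?P1 u1 * pmf ?P2 u2 *
        (indicator (- J1) u1 + indicator (- J2) u2 + ?cfu u1 u2))"
    unfolding source_error_eq by (intro sum_mono mult_left_mono fail_le) simp
  also have "\<dots> = (\<Sum>u1\<in>words n. pmf ?P1 u1 * indicator (- J1) u1) * (\<Sum>u2\<in>words n. pmf ?P2 u2) +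
      (\<Sum>u1\<in>words n. pmf ?P1 u1) * (\<Sum>u2\<in>words n. pmf ?P2 u2 * indicator (- J2) u2) +
      (\<Sum>u1\<in>words n. \<Sum>u2\<in>words n. pmf ?P1 u1 * pmf ?P2 u2 * ?cfu u1 u2)"
    by (rule expand)
  also have "(\<Sum>u1\<in>words n. \<Sum>u2\<in>words n. pmf ?P1 u1 * pmf ?P2 u2 * ?cfu u1 u2) \<le>
      channel_error W n (R1s, R1p, R2s, R2p) e1 e2 d1 d2"
    using avg unfolding q1 channel_error_eq[OF nonneg]
    by (simp add: sum.cartesian_product case_prod_beta')
  finally have "source_error W p1 p2 h1 h2 n ?f1 ?f2 ?g1 ?g2 \<le>
      measure_pmf.prob (iid_pmf n p1) (- J1) + measure_pmf.prob (iid_pmf n p2) (- J2) +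
      channel_error W n (R1s, R1p, R2s, R2p) e1 e2 d1 d2"
    by (simp add: out sum_pmf_iid)
  then show ?thesis using is_code by blast
qed

section \<open>Sequences of codes and the limit of their error\<close>

lemma exists_codes_tendsto_0:
  fixes ok :: "nat \<Rightarrow> 'c \<Rightarrow> bool" and err :: "nat \<Rightarrow> 'c \<Rightarrow> real"
  assumes "\<And>n. \<exists>c. ok n c" and "\<And>n c. 0 \<le> err n c"
    and ev: "\<forall>\<^sub>F n in sequentially. \<exists>c. ok n c \<and> err n c \<le> \<delta> n" and lim: "\<delta> \<longlonglongrightarrow> 0"
  shows "\<exists>c. (\<forall>n. ok n (c n)) \<and> (\<lambda>n. err n (c n)) \<longlonglongrightarrow> 0"
proof -
  \<comment> \<open>A code meeting the bound is chosen whenever one exists and an arbitrary valid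
    code otherwise, so that one sequence covers all block lengths.\<close>
  have "\<forall>n. \<exists>c. ok n c \<and> ((\<exists>c. ok n c \<and> err n c \<le> \<delta> n) \<longrightarrow> err n c \<le> \<delta> n)"
    using assms(1) by blast
  from choice[OF this] obtain c where c: "\<And>n. ok n (c n)"
      "\<And>n. \<exists>c. ok n c \<and> err n c \<le> \<delta> n \<Longrightarrow> err n (c n) \<le> \<delta> n"
    by blast
  have "\<forall>\<^sub>F n in sequentially. norm (err n (c n)) \<le> \<delta> n"
    using ev by (rule eventually_mono) (use c(2) assms(2) in simp)
  then have "(\<lambda>n. err n (c n)) \<longlonglongrightarrow> 0" using lim by (rule Lim_null_comparison)
  then show ?thesis using c(1) by blast
qed

text \<open>For large \<open>n\<close> both sources have blocks that accommodate the messages, and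
  some pair of blocks has conditional error at most twice the source error. The source code
  restricted to that pair becomes a channel code.\<close>

lemma achievable_if_reliably_transmissible:
  fixes W :: "('x1, 'x2, 'y1, 'y2) ichannel"
    and p1 :: "'u1::finite pmf" and p2 :: "'u2::finite pmf"
    and h1 :: "'u1 \<Rightarrow> 'v1::finite" and h2 :: "'u2 \<Rightarrow> 'v2::finite"
  assumes rel: "reliably_transmissible W p1 p2 h1 h2"
    and R1s: "0 \<le> R1s" "R1s < shannon (map_pmf h1 p1) \<or> R1s = 0"
    and R1p: "0 \<le> R1p" "R1p < shannon p1 - shannon (map_pmf h1 p1) \<or> R1p = 0"
    and R2s: "0 \<le> R2s" "R2s < shannon (map_pmf h2 p2) \<or> R2s = 0"
    and R2p: "0 \<le> R2p" "R2p < shannon p2 - shannon (map_pmf h2 p2) \<or> R2p = 0"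
  shows "achievable W (R1s, R1p, R2s, R2p)"
proof -
  let ?R = "(R1s, R1p, R2s, R2p)"
  note nonneg = R1s(1) R1p(1) R2s(1) R2p(1)
  obtain f1 f2 g1 g2 where code: "\<And>n. source_code n (f1 n) (f2 n) (g1 n) (g2 n)"
    and lim: "(\<lambda>n. source_error W p1 p2 h1 h2 n (f1 n) (f2 n) (g1 n) (g2 n)) \<longlonglongrightarrow> 0"
    using rel unfolding reliably_transmissible_def by blast
  let ?se = "\<lambda>n. source_error W p1 p2 h1 h2 n (f1 n) (f2 n) (g1 n) (g2 n)"
  let ?ok = "\<lambda>n (e1 :: nat \<times> nat \<Rightarrow> nat \<Rightarrow> 'x1, e2 :: nat \<times> nat \<Rightarrow> nat \<Rightarrow> 'x2,
    d1 :: (nat \<Rightarrow> 'y1) \<times> nat \<Rightarrow> nat \<times> nat, d2 :: (nat \<Rightarrow> 'y2) \<times> nat \<Rightarrow> nat \<times> nat).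
    channel_code n ?R e1 e2 d1 d2"
  let ?err = "\<lambda>n (e1, e2, d1, d2). channel_error W n ?R e1 e2 d1 d2"
  have err_nonneg: "0 \<le> ?err n c" for n c by (cases c) (simp add: channel_error_def)
  \<comment> \<open>Constant encoders and decoders are valid codes at every block length, including
    those too short for the blocks to exist.\<close>
  have default: "\<exists>c. ?ok n c" for n
  proof -
    obtain x1 :: "nat \<Rightarrow> 'x1" where x1: "x1 \<in> words n" using words_nonempty by blast
    obtain x2 :: "nat \<Rightarrow> 'x2" where x2: "x2 \<in> words n" using words_nonempty by blast
    obtain a b c d where "a \<in> messages n R1s" "b \<in> messages n R1p" "c \<in> messages n R2s" "d \<in> messages n R2p"
      using messages_nonempty[OF nonneg(1), of n] messages_nonempty[OF nonneg(2), of n]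
        messages_nonempty[OF nonneg(3), of n] messages_nonempty[OF nonneg(4), of n] by blast
    then have "?ok n (\<lambda>_. x1, \<lambda>_. x2, \<lambda>_. (a, b), \<lambda>_. (c, d))"
      using x1 x2 by (auto simp: channel_code_def)
    then show ?thesis by (rule exI)
  qed
  have ev: "\<forall>\<^sub>F n in sequentially. \<exists>c. ?ok n c \<and> ?err n c \<le> 2 * ?se n"
    using eventually_exists_uniform_blocks[OF R1s R1p] eventually_exists_uniform_blocks[OF R2s R2p]
  proof eventually_elim
    fix n
    let ?P1 = "iid_pmf n p1" and ?P2 = "iid_pmf n p2"
    assume "\<exists>S \<subseteq> words n. 3 / 4 \<le> measure_pmf.prob ?P1 S \<and>
      (\<forall>u\<in>S. uniform_block n p1 h1 (card (messages n R1s)) (card (messages n R1p))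
        {w \<in> S. word_type n w = word_type n u})"
    then obtain S1 where S1: "S1 \<subseteq> words n" "3 / 4 \<le> measure_pmf.prob ?P1 S1"
      and block1: "\<And>u. u \<in> S1 \<Longrightarrow> uniform_block n p1 h1 (card (messages n R1s)) (card (messages n R1p))
        {w \<in> S1. word_type n w = word_type n u}" by blast
    assume "\<exists>S \<subseteq> words n. 3 / 4 \<le> measure_pmf.prob ?P2 S \<and>
      (\<forall>u\<in>S. uniform_block n p2 h2 (card (messages n R2s)) (card (messages n R2p))
        {w \<in> S. word_type n w = word_type n u})"
    then obtain S2 where S2: "S2 \<subseteq> words n" "3 / 4 \<le> measure_pmf.prob ?P2 S2"
      and block2: "\<And>u. u \<in> S2 \<Longrightarrow> uniform_block n p2 h2 (card (messages n R2s)) (card (messages n R2p))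
        {w \<in> S2. word_type n w = word_type n u}" by blast
    have fin: "finite S1" "finite S2" using finite_subset[OF S1(1)] finite_subset[OF S2(1)] by auto
    let ?sf = "source_fail W h1 h2 n (f1 n) (f2 n) (g1 n) (g2 n)"
    obtain a b where ab: "a \<in> S1" "b \<in> S2"
      and le: "(\<Sum>x\<in>{x \<in> S1. word_type n x = word_type n a}. \<Sum>y\<in>{y \<in> S2. word_type n y = word_type n b}.
          pmf ?P1 x * pmf ?P2 y * ?sf x y) \<le> 2 * ?se n *
          (sum (pmf ?P1) {x \<in> S1. word_type n x = word_type n a} *
           sum (pmf ?P2) {y \<in> S2. word_type n y = word_type n b})"
      using exists_good_block_pair[where ?g1.0 = "word_type n" and ?g2.0 = "word_type n"
            and ?q1.0 = "pmf ?P1" and ?q2.0 = "pmf ?P2" and F = ?sf,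
            OF fin finite_words finite_words S1(1) S2(1) pmf_nonneg pmf_nonneg source_fail_bounds(1)]
        S1(2) S2(2) unfolding source_error_eq measure_measure_pmf_finite[OF fin(1)] measure_measure_pmf_finite[OF fin(2)] by blast
    let ?T1 = "{x \<in> S1. word_type n x = word_type n a}" and ?T2 = "{y \<in> S2. word_type n y = word_type n b}"
    have pos: "0 < sum (pmf ?P1) ?T1" "0 < sum (pmf ?P2) ?T2"
      using block1[OF ab(1)] block2[OF ab(2)] ab fin
      by (auto simp: uniform_block_def intro!: sum_pos)
    obtain e1 e2 d1 d2 where "channel_code n ?R e1 e2 d1 d2"
      and "channel_error W n ?R e1 e2 d1 d2 * (sum (pmf ?P1) ?T1 * sum (pmf ?P2) ?T2) \<le>
        (\<Sum>x\<in>?T1. \<Sum>y\<in>?T2. pmf ?P1 x * pmf ?P2 y * ?sf x y)"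
      using channel_code_from_source_code[OF code nonneg block1[OF ab(1)] block2[OF ab(2)]] by blast
    moreover from this(2) le have "channel_error W n ?R e1 e2 d1 d2 \<le> 2 * ?se n"
      using mult_pos_pos[OF pos] by (meson mult_le_cancel_right_pos order_trans)
    ultimately have "?ok n (e1, e2, d1, d2) \<and> ?err n (e1, e2, d1, d2) \<le> 2 * ?se n" by simp
    then show "\<exists>c. ?ok n c \<and> ?err n c \<le> 2 * ?se n" by blast
  qed
  have "(\<lambda>n. 2 * ?se n) \<longlonglongrightarrow> 2 * 0" by (intro tendsto_mult_left lim)
  then have lim2: "(\<lambda>n. 2 * ?se n) \<longlonglongrightarrow> 0" by simp
  obtain c where c: "\<And>n. ?ok n (c n)" "(\<lambda>n. ?err n (c n)) \<longlonglongrightarrow> 0"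
    using exists_codes_tendsto_0[OF default err_nonneg ev lim2] by blast
  show ?thesis
    unfolding achievable_def prod.case
    using nonneg c
    by (intro conjI exI[of _ "\<lambda>n. fst (c n)"] exI[of _ "\<lambda>n. fst (snd (c n))"]
        exI[of _ "\<lambda>n. fst (snd (snd (c n)))"] exI[of _ "\<lambda>n. snd (snd (snd (c n)))"])
      (simp_all add: case_prod_beta')
qed

text \<open>Rates strictly above the entropies leave room to index all jointly typical words by
  messages. The error is then at most the two atypicality probabilities plus the channel error, all
  of which vanish.\<close>

lemma reliably_transmissible_if_achievable:
  fixes W :: "('x1, 'x2, 'y1, 'y2) ichannel"
    and p1 :: "'u1::finite pmf" and p2 :: "'u2::finite pmf"
    and h1 :: "'u1 \<Rightarrow> 'v1::finite" and h2 :: "'u2 \<Rightarrow> 'v2::finite"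
  assumes ach: "achievable W (R1s, R1p, R2s, R2p)"
    and R1: "shannon (map_pmf h1 p1) < R1s" "shannon p1 - shannon (map_pmf h1 p1) < R1p"
    and R2: "shannon (map_pmf h2 p2) < R2s" "shannon p2 - shannon (map_pmf h2 p2) < R2p"
  shows "reliably_transmissible W p1 p2 h1 h2"
proof -
  let ?R = "(R1s, R1p, R2s, R2p)"
  obtain e1 e2 d1 d2 where code: "\<And>n. channel_code n ?R (e1 n) (e2 n) (d1 n) (d2 n)"
    and lim: "(\<lambda>n. channel_error W n ?R (e1 n) (e2 n) (d1 n) (d2 n)) \<longlonglongrightarrow> 0"
    and nonneg: "0 \<le> R1s" "0 \<le> R1p" "0 \<le> R2s" "0 \<le> R2p"
    using ach unfolding achievable_def by auto
  let ?ce = "\<lambda>n. channel_error W n ?R (e1 n) (e2 n) (d1 n) (d2 n)"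
  \<comment> \<open>The shared index needs one \<open>\<epsilon>\<close> and the private index two,
    as in the counts of images and of fibres.\<close>
  have slack: "\<exists>\<epsilon>>0. Hs + \<epsilon> \<le> Rs \<and> Hp + 2 * \<epsilon> \<le> Rp" if "Hs < Rs" "Hp < Rp" for Hs Hp Rs Rp :: real
    using that by (intro exI[of _ "min (Rs - Hs) ((Rp - Hp) / 2)"]) (auto simp: min_def field_simps)
  obtain \<epsilon>1 where \<epsilon>1: "0 < \<epsilon>1" "shannon (map_pmf h1 p1) + \<epsilon>1 \<le> R1s"
      "shannon p1 - shannon (map_pmf h1 p1) + 2 * \<epsilon>1 \<le> R1p"
    using slack[OF R1] by blast
  obtain \<epsilon>2 where \<epsilon>2: "0 < \<epsilon>2" "shannon (map_pmf h2 p2) + \<epsilon>2 \<le> R2s"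
      "shannon p2 - shannon (map_pmf h2 p2) + 2 * \<epsilon>2 \<le> R2p"
    using slack[OF R2] by blast
  let ?ok = "\<lambda>n (f1 :: (nat \<Rightarrow> 'u1) \<Rightarrow> nat \<Rightarrow> 'x1, f2 :: (nat \<Rightarrow> 'u2) \<Rightarrow> nat \<Rightarrow> 'x2,
    g1 :: (nat \<Rightarrow> 'y1) \<times> (nat \<Rightarrow> 'v2) \<Rightarrow> nat \<Rightarrow> 'u1, g2 :: (nat \<Rightarrow> 'y2) \<times> (nat \<Rightarrow> 'v1) \<Rightarrow> nat \<Rightarrow> 'u2).
    source_code n f1 f2 g1 g2"
  let ?err = "\<lambda>n (f1, f2, g1, g2). source_error W p1 p2 h1 h2 n f1 f2 g1 g2"
  let ?\<delta> = "\<lambda>n. measure_pmf.prob (iid_pmf n p1) (- jointly_typical n \<epsilon>1 p1 h1) +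
    measure_pmf.prob (iid_pmf n p2) (- jointly_typical n \<epsilon>2 p2 h2) + ?ce n"
  have ex: "\<exists>c. ?ok n c \<and> ?err n c \<le> ?\<delta> n" for n
  proof -
    obtain s1 t1 where st1: "s1 \<in> UNIV \<rightarrow> messages n R1s" "t1 \<in> UNIV \<rightarrow> messages n R1p"
      "inj_on (\<lambda>u. (s1 (map_word n h1 u), t1 u)) (jointly_typical n \<epsilon>1 p1 h1)"
      using exists_source_indexing[OF \<epsilon>1(2,3) nonneg(1,2)] by blast
    obtain s2 t2 where st2: "s2 \<in> UNIV \<rightarrow> messages n R2s" "t2 \<in> UNIV \<rightarrow> messages n R2p"
      "inj_on (\<lambda>u. (s2 (map_word n h2 u), t2 u)) (jointly_typical n \<epsilon>2 p2 h2)"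
      using exists_source_indexing[OF \<epsilon>2(2,3) nonneg(3,4)] by blast
    obtain f1 f2 g1 g2 where "source_code n f1 f2 g1 g2" "source_error W p1 p2 h1 h2 n f1 f2 g1 g2 \<le> ?\<delta> n"
      using source_code_from_channel_code[OF code nonneg st1 jointly_typical_subset st2 jointly_typical_subset,
        where W = W and ?p1.0 = p1 and ?p2.0 = p2]
      by (elim exE conjE)
    then have "?ok n (f1, f2, g1, g2) \<and> ?err n (f1, f2, g1, g2) \<le> ?\<delta> n"
      unfolding prod.case by (rule conjI)
    then show ?thesis by (rule exI)
  qed
  have err_nonneg: "0 \<le> ?err n c" for n c by (cases c) (simp add: source_error_def)
  have ok: "\<exists>c. ?ok n c" for n using ex by blast
  have "?\<delta> \<longlonglongrightarrow> 0 + 0 + 0"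
    by (intro tendsto_add jointly_typical_probability lim \<epsilon>1 \<epsilon>2)
  then have \<delta>: "?\<delta> \<longlonglongrightarrow> 0" by simp
  obtain c where c: "\<And>n. ?ok n (c n)" "(\<lambda>n. ?err n (c n)) \<longlonglongrightarrow> 0"
    using exists_codes_tendsto_0[of ?ok ?err ?\<delta>, OF ok err_nonneg always_eventually[OF allI[OF ex]] \<delta>]
    by blast
  show ?thesis
    unfolding reliably_transmissible_def
    using c
    by (intro exI[of _ "\<lambda>n. fst (c n)"] exI[of _ "\<lambda>n. fst (snd (c n))"]
        exI[of _ "\<lambda>n. fst (snd (snd (c n)))"] exI[of _ "\<lambda>n. snd (snd (snd (c n)))"])
      (simp add: case_prod_beta')
qed

text \<open>An interior point of a closure need not lie in \<open>S\<close>, but it is a limit of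
  points of the open orthant strictly above it. That orthant therefore meets the interior in a
  nonempty open set, in which \<open>S\<close> is dense.\<close>

lemma exists_dominating_point:
  fixes a b c d :: real
  assumes "(a, b, c, d) \<in> interior (closure S)"
  shows "\<exists>a' b' c' d'. (a', b', c', d') \<in> S \<and> a < a' \<and> b < b' \<and> c < c' \<and> d < d'"
proof -
  let ?Q = "{a<..} \<times> {b<..} \<times> {c<..} \<times> {d<..}" and ?I = "interior (closure S)"
  have "open ?Q" by (intro open_Times open_greaterThan)
  have "(a, b, c, d) \<in> closure ?Q" by (simp add: closure_Times)
  then have "?I \<inter> ?Q \<noteq> {}"
    using open_Int_closure_eq_empty[of ?I ?Q] assms by auto
  then have "(?I \<inter> ?Q) \<inter> closure S \<noteq> {}" using interior_subset by blast
  then have "(?I \<inter> ?Q) \<inter> S \<noteq> {}"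
    using open_Int_closure_eq_empty[of "?I \<inter> ?Q" S] \<open>open ?Q\<close> by auto
  then show ?thesis by fastforce
qed

section \<open>The two directions of source-channel separation\<close>

theorem theorem3:
  fixes W :: "'x1::finite \<Rightarrow> 'x2::finite \<Rightarrow> ('y1::finite \<times> 'y2::finite) pmf"
    and p1 :: "'u1::finite pmf" and p2 :: "'u2::finite pmf"
    and h1 :: "'u1 \<Rightarrow> 'v1::finite" and h2 :: "'u2 \<Rightarrow> 'v2::finite"
  shows
    "((entropy_pmf p1 h1, cond_entropy_pmf p1 (\<lambda>u. u) h1,
       entropy_pmf p2 h2, cond_entropy_pmf p2 (\<lambda>u. u) h2) \<in> interior (capacity_region W)
      \<longrightarrow> reliably_transmissible W p1 p2 h1 h2) \<and>
     ((entropy_pmf p1 h1, cond_entropy_pmf p1 (\<lambda>u. u) h1,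
       entropy_pmf p2 h2, cond_entropy_pmf p2 (\<lambda>u. u) h2) \<notin> capacity_region W
      \<longrightarrow> \<not> reliably_transmissible W p1 p2 h1 h2)"
  (is "(?H \<in> _ \<longrightarrow> ?rel) \<and> _")
proof (intro conjI impI)
  assume "?H \<in> interior (capacity_region W)"
  then obtain R1s R1p R2s R2p where "achievable W (R1s, R1p, R2s, R2p)"
    "entropy_pmf p1 h1 < R1s" "cond_entropy_pmf p1 (\<lambda>u. u) h1 < R1p"
    "entropy_pmf p2 h2 < R2s" "cond_entropy_pmf p2 (\<lambda>u. u) h2 < R2p"
    using exists_dominating_point unfolding capacity_region_def by blast
  then show ?rel
    by (intro reliably_transmissible_if_achievable) (simp_all add: entropy_pmf_eq cond_entropy_pmf_eq)
next
  assume "?H \<notin> capacity_region W"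
  show "\<not> ?rel"
  proof
    assume rel: ?rel
    \<comment> \<open>The rates approach the entropies from below and are cut off at 0. Where the
      cutoff acts the rate is 0, which is the second alternative for the rates in
      \<open>achievable_if_reliably_transmissible\<close>. The entropy quadruplet is then a limit of
      achievable ones.\<close>
    define r where "r n x = max 0 (x - inverse (real (Suc n)))" for n x
    have r: "0 \<le> r n x" "r n x < x \<or> r n x = 0" for n x
      unfolding r_def by (auto simp: max_def)
    have r_lim: "(\<lambda>n. r n x) \<longlonglongrightarrow> x" if "0 \<le> x" for x
    proof -
      have "(\<lambda>n. r n x) \<longlonglongrightarrow> max 0 (x - 0)"
        unfolding r_def by (intro tendsto_intros LIMSEQ_inverse_real_of_nat)
      then show ?thesis using that by simp
    qed
    have H: "0 \<le> entropy_pmf p1 h1" "0 \<le> entropy_pmf p2 h2"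
      by (simp_all add: entropy_pmf_eq shannon_nonneg)
    let ?R = "\<lambda>n. (r n (entropy_pmf p1 h1), r n (cond_entropy_pmf p1 (\<lambda>u. u) h1),
      r n (entropy_pmf p2 h2), r n (cond_entropy_pmf p2 (\<lambda>u. u) h2))"
    have "achievable W (?R n)" for n
      using r by (intro achievable_if_reliably_transmissible[OF rel])
        (simp_all add: entropy_pmf_eq cond_entropy_pmf_eq)
    moreover have "?R \<longlonglongrightarrow> ?H"
      by (intro tendsto_Pair r_lim H cond_entropy_pmf_nonneg)
    ultimately have "?H \<in> capacity_region W"
      unfolding capacity_region_def closure_sequential by (intro exI[of _ ?R]) simp
    then show False using \<open>?H \<notin> capacity_region W\<close> by simp
  qed
qed

end
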